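(* Fix quantum states $\boldsymbol\rho_1,\dots,\boldsymbol\rho_m$ on $\mathbb{C}^d$, labels $y_1,\dots,y_m\in\mathbb{R}$, a $d\times d$ Hermitian matrix $\mathbf{M}_0$, and a non-zero traceless $d\times d$ Hermitian matrix $\mathbf{H}$. For each $p\ge1$ consider the random periodic ansatz $$\mathbf{U}(\boldsymbol\theta)=\mathbf{U}_pe^{-i\theta_p\mathbf{H}}\cdots\mathbf{U}_1e^{-i\theta_1\mathbf{H}}\mathbf{U}_0,\qquad \boldsymbol\theta\in\mathbb{R}^p,$$ with $\mathbf{U}_0,\dots,\mathbf{U}_p$ i.i.d. Haar distributed on $SU(d)$, and let $\mathbf{M}(\boldsymbol\theta)=\mathbf{U}(\boldsymbol\theta)^\dagger\mathbf{M}_0\mathbf{U}(\boldsymbol\theta)$, $L(\boldsymbol\theta)=\frac1{2m}\sum_{j=1}^m(\operatorname{tr}(\boldsymbol\rho_j\mathbf{M}(\boldsymbol\theta))-y_j)^2$. Let $\boldsymbol\theta(t)$ follow the gradient flow $\frac{d\boldsymbol\theta}{dt}=-\eta\nabla L(\boldsymbol\theta(t))$ with $\eta=\frac{m}{p}\frac{d^2-1}{\operatorname{tr}(\mathbf{H}^2)}$ from an initial point $\boldsymbol\theta(0)$, and write $\mathbf{M}(t)=\mathbf{M}(\boldsymbol\theta(t))$, $L(t)=L(\boldsymbol\theta(t))$ and $(\mathbf{K}_{\mathsf{asym}}(t))_{ij}=\operatorname{tr}\big(i[\mathbf{M}(t),\boldsymbol\rho_i]\;i[\mathbf{M}(t),\boldsymbol\rho_j]\big)$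 for $1\le i,j\le m$. Then for every constant $C_0>0$ and every $\delta\in(0,1)$ there is $p_0$ such that for all $p\ge p_0$ and every (deterministic) $\boldsymbol\theta(0)\in\mathbb{R}^p$, with probability at least $1-\delta$ over $\mathbf{U}_0,\dots,\mathbf{U}_p$ the following holds: if the smallest eigenvalue of $\mathbf{K}_{\mathsf{asym}}(t)$ is greater than $C_0$ for all $t\ge0$, then the loss converges to zero at a linear rate, $$L(t)\le L(0)\exp\!\Big(-\frac{C_0t}{2}\Big)\qquad\text{for all }t\ge0.$$
   Context: A quantum state on $\mathbb{C}^d$ is a positive semidefinite $d\times d$ Hermitian matrix of trace $1$. $[\mathbf A,\mathbf B]=\mathbf{AB}-\mathbf{BA}$; the factor $i$ multiplying commutators is the imaginary unit. *)

theory Defs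
  imports "HOL-Probability.Probability"
begin

text \<open>On \<^typ>\<open>complex^'n^'n\<close> the library operations \<^term>\<open>(*)\<close>, \<^term>\<open>1\<close>
  and \<^term>\<open>(^)\<close> are componentwise, and \<^term>\<open>exp\<close> is not available; the matrix
  versions are therefore introduced here.\<close>

definition cscale :: "complex \<Rightarrow> complex^'n^'n \<Rightarrow> complex^'n^'n" where
  "cscale c A = (\<chi> i j. c * A $ i $ j)"

definition dagger :: "complex^'n^'n \<Rightarrow> complex^'n^'n" where
  "dagger A = (\<chi> i j. cnj (A $ j $ i))"

definition hermitian :: "complex^'n^'n \<Rightarrow> bool" where
  "hermitian A \<longleftrightarrow> dagger A = A"

definition commutator :: "complex^'n^'n \<Rightarrow> complex^'n^'n \<Rightarrow> complex^'n^'n" where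
  "commutator A B = A ** B - B ** A"

primrec mat_pow :: "complex^'n^'n \<Rightarrow> nat \<Rightarrow> complex^'n^'n" where
  "mat_pow A 0 = mat 1"
| "mat_pow A (Suc k) = A ** mat_pow A k"

definition mat_exp :: "complex^'n^'n \<Rightarrow> complex^'n^'n" where
  "mat_exp A = (\<Sum>k. (1 / fact k) *\<^sub>R mat_pow A k)"

text \<open>For a Hermitian matrix the quadratic form is real, so \<^term>\<open>Re\<close> loses nothing.\<close>

definition quantum_state :: "complex^'n^'n \<Rightarrow> bool" where
  "quantum_state \<rho> \<longleftrightarrow>
     hermitian \<rho> \<and>
     (\<forall>v :: complex^'n. 0 \<le> Re (\<Sum>i\<in>UNIV. cnj (v $ i) * (\<rho> *v v) $ i)) \<and>
     trace \<rho> = 1"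

text \<open>The set of eigenvalues is finite and, for symmetric \<^term>\<open>A\<close>, non-empty; the
  definition is only meant for symmetric matrices.\<close>

definition smallest_eigenvalue :: "real^'m^'m \<Rightarrow> real" where
  "smallest_eigenvalue A = Min {c. \<exists>v. v \<noteq> 0 \<and> A *v v = c *\<^sub>R v}"

definition SU :: "(complex^'n^'n) set" where
  "SU = {U. U ** dagger U = mat 1 \<and> dagger U ** U = mat 1 \<and> det U = 1}"

text \<open>The left-invariant Borel probability measure on the compact group \<^term>\<open>SU\<close>; such a
  measure exists and is unique.\<close>

definition haar_SU :: "(complex^'n^'n) measure \<Rightarrow> bool" where
  "haar_SU \<mu> \<longleftrightarrow>
     prob_space \<mu> \<and>
     sets \<mu> = sets (restrict_space borel SU) \<and>
     (\<forall>V\<in>SU. distr \<mu> \<mu> (\<lambda>U. V ** U) = \<mu>)"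

text \<open>The law of i.i.d. Haar distributed \<open>U\<^sub>0, \<dots>, U\<^sub>p\<close>.\<close>

definition iid_law :: "(complex^'n^'n) measure \<Rightarrow> nat \<Rightarrow> (nat \<Rightarrow> complex^'n^'n) measure" where
  "iid_law \<mu> p = (\<Pi>\<^sub>M k\<in>{0..p}. \<mu>)"

text \<open>As with \<^term>\<open>AE x in P. \<phi> x\<close>, the property itself need not be known to be measurable:
  it has to hold on some event of probability at least \<^term>\<open>q\<close>.  For a measurable property
  this is the same as \<open>q \<le> measure P {x \<in> space P. \<phi> x}\<close>, as shown below.\<close>

definition with_prob_ge :: "'w measure \<Rightarrow> real \<Rightarrow> ('w \<Rightarrow> bool) \<Rightarrow> bool" where
  "with_prob_ge P q \<phi> \<longleftrightarrow> (\<exists>A\<in>sets P. q \<le> measure P A \<and> (\<forall>x\<in>A. \<phi> x))"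

lemma (in prob_space) with_prob_ge_iff:
  assumes "{x \<in> space M. \<phi> x} \<in> sets M"
  shows "with_prob_ge M q \<phi> \<longleftrightarrow> q \<le> prob {x \<in> space M. \<phi> x}"
proof
  assume "with_prob_ge M q \<phi>"
  then obtain A where A: "A \<in> sets M" "q \<le> prob A" "\<forall>x\<in>A. \<phi> x"
    unfolding with_prob_ge_def by blast
  have "A \<subseteq> {x \<in> space M. \<phi> x}"
    using A sets.sets_into_space by blast
  then have "prob A \<le> prob {x \<in> space M. \<phi> x}"
    using assms by (rule finite_measure_mono)
  then show "q \<le> prob {x \<in> space M. \<phi> x}"
    using A(2) by linarith
next
  assume "q \<le> prob {x \<in> space M. \<phi> x}"
  then show "with_prob_ge M q \<phi>"
    unfolding with_prob_ge_def using assms by blast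
qed

text \<open>Points of \<open>\<real>\<^sup>p\<close> are functions \<^typ>\<open>nat \<Rightarrow> real\<close> of which only the
  coordinates \<open>1, \<dots>, p\<close> are used; similarly for the family \<open>U\<^sub>0, \<dots>, U\<^sub>p\<close>.\<close>

primrec ansatz ::
  "(nat \<Rightarrow> complex^'n^'n) \<Rightarrow> complex^'n^'n \<Rightarrow> nat \<Rightarrow> (nat \<Rightarrow> real) \<Rightarrow> complex^'n^'n" where
  "ansatz U H 0 \<theta> = U 0"
| "ansatz U H (Suc l) \<theta> =
     U (Suc l) ** mat_exp (cscale (- \<i> * complex_of_real (\<theta> (Suc l))) H) ** ansatz U H l \<theta>"

definition observable ::
  "(nat \<Rightarrow> complex^'n^'n) \<Rightarrow> complex^'n^'n \<Rightarrow> complex^'n^'n \<Rightarrow> nat \<Rightarrow> (nat \<Rightarrow> real)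
     \<Rightarrow> complex^'n^'n" where
  "observable U H M\<^sub>0 p \<theta> = dagger (ansatz U H p \<theta>) ** M\<^sub>0 ** ansatz U H p \<theta>"

text \<open>The trace of a product of two Hermitian matrices is real, so that taking \<^term>\<open>Re\<close> in
  \<open>loss\<close>, \<open>K_asym\<close> and \<open>learning_rate\<close> only converts the type.\<close>

lemma trace_hermitian_mult_real:
  assumes "hermitian A" "hermitian B"
  shows "Im (trace (A ** B)) = 0"
proof -
  have a: "cnj (A $ i $ j) = A $ j $ i" and b: "cnj (B $ i $ j) = B $ j $ i" for i j
    using assms by (auto simp: hermitian_def dagger_def vec_eq_iff)
  have "cnj (trace (A ** B)) = (\<Sum>i\<in>UNIV. \<Sum>j\<in>UNIV. cnj (A $ i $ j) * cnj (B $ j $ i))"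
    by (simp add: trace_def matrix_matrix_mult_def)
  also have "\<dots> = (\<Sum>i\<in>UNIV. \<Sum>j\<in>UNIV. A $ j $ i * B $ i $ j)"
    by (simp only: a b)
  also have "\<dots> = trace (A ** B)"
    by (subst sum.swap) (simp add: trace_def matrix_matrix_mult_def)
  finally show ?thesis
    by (metis Reals_cnj_iff complex_is_Real_iff)
qed

lemma hermitian_observable:
  fixes M\<^sub>0 :: "complex^'n^'n"
  assumes "hermitian M\<^sub>0"
  shows "hermitian (observable U H M\<^sub>0 p \<theta>)"
proof -
  have mult: "dagger (A ** B) = dagger B ** dagger A" for A B :: "complex^'n^'n"
    by (simp add: dagger_def matrix_matrix_mult_def vec_eq_iff mult.commute)
  have "dagger (dagger A) = A" for A :: "complex^'n^'n"
    by (simp add: dagger_def vec_eq_iff)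
  with assms show ?thesis
    by (simp add: hermitian_def observable_def mult matrix_mul_assoc)
qed

lemma hermitian_i_commutator:
  assumes "hermitian A" "hermitian B"
  shows "hermitian (cscale \<i> (commutator A B))"
proof -
  have a: "cnj (A $ i $ j) = A $ j $ i" and b: "cnj (B $ i $ j) = B $ j $ i" for i j
    using assms by (auto simp: hermitian_def dagger_def vec_eq_iff)
  show ?thesis
    by (simp add: hermitian_def dagger_def cscale_def commutator_def vec_eq_iff
        matrix_matrix_mult_def a b mult.commute right_diff_distrib)
qed

definition loss ::
  "('m::finite \<Rightarrow> complex^'n^'n) \<Rightarrow> ('m \<Rightarrow> real) \<Rightarrow> (nat \<Rightarrow> complex^'n^'n) \<Rightarrow>
     complex^'n^'n \<Rightarrow> complex^'n^'n \<Rightarrow> nat \<Rightarrow> (nat \<Rightarrow> real) \<Rightarrow> real" where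
  "loss \<rho> y U H M\<^sub>0 p \<theta> =
     1 / (2 * real CARD('m)) *
       (\<Sum>j\<in>UNIV. (Re (trace (\<rho> j ** observable U H M\<^sub>0 p \<theta>)) - y j)\<^sup>2)"

definition K_asym ::
  "('m::finite \<Rightarrow> complex^'n^'n) \<Rightarrow> complex^'n^'n \<Rightarrow> real^'m^'m" where
  "K_asym \<rho> M =
     (\<chi> i j. Re (trace (cscale \<i> (commutator M (\<rho> i)) ** cscale \<i> (commutator M (\<rho> j)))))"

definition learning_rate :: "nat \<Rightarrow> complex^'n^'n \<Rightarrow> nat \<Rightarrow> real" where
  "learning_rate m H p =
     real m / real p * ((real CARD('n))\<^sup>2 - 1) / Re (trace (H ** H))"

definition partial_deriv :: "nat \<Rightarrow> ((nat \<Rightarrow> real) \<Rightarrow> real) \<Rightarrow> (nat \<Rightarrow> real) \<Rightarrow> real" where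
  "partial_deriv l f \<theta> = deriv (\<lambda>x. f (\<theta>(l := x))) (\<theta> l)"

definition gradient_flow ::
  "nat \<Rightarrow> real \<Rightarrow> ((nat \<Rightarrow> real) \<Rightarrow> real) \<Rightarrow> (nat \<Rightarrow> real) \<Rightarrow> (real \<Rightarrow> nat \<Rightarrow> real) \<Rightarrow> bool" where
  "gradient_flow p \<eta> L \<theta>\<^sub>0 \<theta> \<longleftrightarrow>
     (\<forall>l\<in>{1..p}. \<theta> 0 l = \<theta>\<^sub>0 l) \<and>
     (\<forall>t\<ge>0. \<forall>l\<in>{1..p}.
        ((\<lambda>s. \<theta> s l) has_real_derivative - \<eta> * partial_deriv l L (\<theta> t)) (at t within {0..}))"

end

theory Submission
  imports Defs
begin

text \<open>Let \<open>V\<^sub>k\<close> be the partial circuit up to \<open>U\<^sub>k\<close> and \<open>H\<^sub>k = V\<^sub>k\<^sup>\<dagger> H V\<^sub>k\<close>. Along the flow \<open>L' = - \<Sum>\<^sub>k \<langle>H\<^sub>k, X\<rangle>\<^sup>2 / (m p \<kappa>)\<close>,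
  where \<open>\<kappa> = tr H\<^sup>2 / (d\<^sup>2 - 1)\<close> and \<open>X\<close> is the combination of the matrices \<open>i[M, \<rho>\<^sub>j]\<close> weighted by the
  residuals, so that \<open>\<parallel>X\<parallel>\<^sup>2\<close> is the quadratic form of \<open>K_asym\<close> at the residuals. It therefore suffices
  that \<open>\<Sum>\<^sub>k \<langle>H\<^sub>k, X\<rangle>\<^sup>2 \<ge> p \<kappa> \<parallel>X\<parallel>\<^sup>2 / 4\<close> for all traceless Hermitian \<open>X\<close> and all \<open>\<theta>\<close> on the path.

  At the deterministic starting point the \<open>V\<^sub>k\<close> are Haar distributed and uncorrelated, and
  \<open>E \<langle>H\<^sub>k, X\<rangle>\<^sup>2 = \<kappa> \<parallel>X\<parallel>\<^sup>2\<close>, so that Chebyshev's inequality applies. If every coordinate of \<open>\<theta>\<close> has moved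
  by at most \<open>R / p\<close>, then \<open>H\<^sub>k\<close> has become \<open>Q\<^sub>k\<^sup>\<dagger> H\<^sub>k Q\<^sub>k\<close> with unitaries \<open>Q\<^sub>k\<close> that vary by \<open>O(1/p)\<close> from one
  \<open>k\<close> to the next. Splitting the indices into a fixed number of blocks on which \<open>Q\<^sub>k\<close> is almost
  constant, the invariance of the mean under conjugation extends the bound to all such \<open>\<theta>\<close> on a
  single event. Conversely, exponential decay of \<open>L\<close> makes the length of the path of every coordinate
  \<open>O(1/p)\<close>, which closes the argument by continuity in \<open>t\<close>.\<close>

subsection \<open>Matrix algebra\<close>

text \<open>The determinant is left free: the diagonal and Hadamard matrices used for the moments
  lie outside \<open>SU\<close> in general, and phases cancel in conjugations anyway.\<close>

definition unitary :: "complex^'n^'n \<Rightarrow> bool" where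
  "unitary U \<longleftrightarrow> U ** dagger U = mat 1 \<and> dagger U ** U = mat 1"

lemma dagger_mult: "dagger (A ** B) = dagger B ** dagger A"
  by (simp add: dagger_def matrix_matrix_mult_def vec_eq_iff mult.commute)

lemma dagger_dagger [simp]: "dagger (dagger A) = A"
  by (simp add: dagger_def vec_eq_iff)

lemma dagger_mat_1 [simp]: "dagger (mat 1) = mat 1"
  by (auto simp: dagger_def vec_eq_iff mat_def)

lemma dagger_add: "dagger (A + B) = dagger A + dagger B"
  by (simp add: dagger_def vec_eq_iff)

lemma dagger_diff: "dagger (A - B) = dagger A - dagger B"
  by (simp add: dagger_def vec_eq_iff)

lemma dagger_scaleR: "dagger (r *\<^sub>R A) = r *\<^sub>R dagger A"
  by (simp add: dagger_def vec_eq_iff)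

lemma dagger_cscale: "dagger (cscale c A) = cscale (cnj c) (dagger A)"
  by (simp add: dagger_def cscale_def vec_eq_iff)

lemma dagger_sum: "dagger (\<Sum>i\<in>S. A i) = (\<Sum>i\<in>S. dagger (A i))"
  by (simp add: dagger_def vec_eq_iff)

lemma cscale_mult_left: "cscale c A ** B = cscale c (A ** B)"
  by (simp add: cscale_def vec_eq_iff matrix_matrix_mult_def sum_distrib_left mult.assoc)

lemma cscale_mult_right: "A ** cscale c B = cscale c (A ** B)"
  by (simp add: cscale_def vec_eq_iff matrix_matrix_mult_def sum_distrib_left mult.left_commute)

lemma cscale_cscale: "cscale a (cscale b A) = cscale (a * b) A"
  by (simp add: cscale_def vec_eq_iff mult.assoc)

lemma cscale_1 [simp]: "cscale 1 A = A"
  by (simp add: cscale_def vec_eq_iff)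

lemma cscale_0 [simp]: "cscale 0 A = 0"
  by (simp add: cscale_def vec_eq_iff)

lemma cscale_add: "cscale c (A + B) = cscale c A + cscale c B"
  by (simp add: cscale_def vec_eq_iff algebra_simps)

lemma cscale_scaleR: "cscale c (r *\<^sub>R A) = r *\<^sub>R cscale c A"
  by (simp add: cscale_def vec_eq_iff)

lemma trace_cscale: "trace (cscale c A) = c * trace A"
  by (simp add: trace_def cscale_def sum_distrib_left)

lemma trace_scaleR: "trace (r *\<^sub>R A) = r *\<^sub>R trace (A :: complex^'n^'n)"
  by (simp add: trace_def scaleR_sum_right)

lemma trace_commutator: "trace (commutator A B) = 0"
  by (simp add: commutator_def trace_sub trace_mul_sym[of A B])

text \<open>Source of the product rule, of continuity, and of a bound on
  \<open>norm (A ** B)\<close> up to a constant \<open>K\<close> whose value never matters.\<close>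

lemma bounded_bilinear_matrix_mult:
  "bounded_bilinear ((**) :: complex^'n^'n \<Rightarrow> complex^'n^'n \<Rightarrow> complex^'n^'n)"
  unfolding bilinear_conv_bounded_bilinear[symmetric] bilinear_def
  by (auto intro!: linearI simp: matrix_matrix_mult_def vec_eq_iff algebra_simps sum.distrib
      scaleR_sum_right)

interpretation matrix_mult:
  bounded_bilinear "(**) :: complex^'n^'n \<Rightarrow> complex^'n^'n \<Rightarrow> complex^'n^'n"
  by (rule bounded_bilinear_matrix_mult)

lemma bounded_linear_dagger: "bounded_linear (dagger :: complex^'n^'n \<Rightarrow> _)"
  unfolding linear_conv_bounded_linear[symmetric]
  by (intro linearI dagger_add dagger_scaleR)

lemma norm_matrix_mult_le:
  obtains K :: real where "K > 0"
    "\<And>(A :: complex^'n^'n) (B :: complex^'n^'n). norm (A ** B) \<le> norm A * norm B * K"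
  using matrix_mult.pos_bounded by blast

text \<open>The inner product of \<open>complex^'n^'n\<close> as a real vector space is the real
  Hilbert-Schmidt product and \<open>norm\<close> is the Frobenius norm, which makes both unitarily
  invariant.\<close>

lemma inner_eq_trace: "A \<bullet> B = Re (trace (dagger A ** B))" for A B :: "complex^'n^'n"
proof -
  have "Re (trace (dagger A ** B)) = (\<Sum>i\<in>UNIV. \<Sum>k\<in>UNIV. A $ k $ i \<bullet> B $ k $ i)"
    by (simp add: trace_def matrix_matrix_mult_def dagger_def inner_complex_def)
  also have "\<dots> = A \<bullet> B"
    unfolding inner_vec_def by (rule sum.swap)
  finally show ?thesis by simp
qed

lemma inner_hermitian: "hermitian A \<Longrightarrow> A \<bullet> B = Re (trace (A ** B))"
  by (simp add: inner_eq_trace hermitian_def)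

section \<open>Unitary matrices and unitary invariance of the norm\<close>

lemma unitary_dagger [simp]: "unitary (dagger U) \<longleftrightarrow> unitary U"
  by (auto simp: unitary_def)

lemma unitary_mult:
  assumes "unitary A" "unitary B"
  shows "unitary (A ** B)"
proof -
  have "A ** B ** (dagger B ** dagger A) = A ** (B ** dagger B) ** dagger A"
    "dagger B ** dagger A ** (A ** B) = dagger B ** (dagger A ** A) ** B"
    by (simp_all only: matrix_mul_assoc)
  with assms show ?thesis
    by (simp add: unitary_def dagger_mult)
qed

lemma unitary_SU: "U \<in> SU \<Longrightarrow> unitary U"
  by (simp add: unitary_def SU_def)

lemma unitary_cancel:
  assumes "unitary U"
  shows "dagger U ** (U ** A) = A" "U ** (dagger U ** A) = A"
    "A ** U ** dagger U = A" "A ** dagger U ** U = A"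
  using assms unfolding unitary_def
  by (metis matrix_mul_assoc matrix_mul_lid matrix_mul_rid)+

lemma inner_matrix_left: "(A ** B) \<bullet> C = B \<bullet> (dagger A ** C)"
  for A B C :: "complex^'n^'n"
  by (simp add: inner_eq_trace dagger_mult matrix_mul_assoc)

lemma inner_matrix_right: "(A ** B) \<bullet> C = A \<bullet> (C ** dagger B)"
  for A B C :: "complex^'n^'n"
  using trace_mul_sym[of "dagger B" "dagger A ** C"]
  by (simp add: inner_eq_trace dagger_mult matrix_mul_assoc)

text \<open>Moves a conjugation of the generator onto the test matrix, so that a change of \<theta>
  can be absorbed into \<open>X\<close>.\<close>

lemma inner_conj: "(dagger V ** A ** V) \<bullet> B = A \<bullet> (V ** B ** dagger V)"
  for A B V :: "complex^'n^'n"
  by (simp only: inner_matrix_right[of "dagger V ** A"] inner_matrix_left[of "dagger V"]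
      dagger_dagger matrix_mul_assoc)

lemma norm_unitary_left: "unitary U \<Longrightarrow> norm (U ** A) = norm A"
  for A U :: "complex^'n^'n"
  by (simp add: norm_eq_sqrt_inner inner_matrix_left unitary_cancel)

lemma norm_unitary_right: "unitary U \<Longrightarrow> norm (A ** U) = norm A"
  for A U :: "complex^'n^'n"
  by (simp add: norm_eq_sqrt_inner inner_matrix_right unitary_cancel)

lemma norm_conj:
  fixes A V :: "complex^'n^'n"
  assumes "unitary V"
  shows "norm (V ** A ** dagger V) = norm A" "norm (dagger V ** A ** V) = norm A"
  using assms by (simp_all add: norm_unitary_left norm_unitary_right)

lemma trace_conj: "unitary V \<Longrightarrow> trace (V ** A ** dagger V) = trace A"
  by (subst trace_mul_sym) (simp add: unitary_cancel)

lemma hermitian_conj: "hermitian A \<Longrightarrow> hermitian (V ** A ** dagger V)"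
  by (simp add: hermitian_def dagger_mult matrix_mul_assoc)

lemma hermitian_conj': "hermitian A \<Longrightarrow> hermitian (dagger V ** A ** V)"
  by (simp add: hermitian_def dagger_mult matrix_mul_assoc)

lemma hermitian_scaleR: "hermitian A \<Longrightarrow> hermitian (r *\<^sub>R A)"
  by (simp add: hermitian_def dagger_scaleR)

lemma hermitian_sum: "(\<And>i. i \<in> S \<Longrightarrow> hermitian (A i)) \<Longrightarrow> hermitian (\<Sum>i\<in>S. A i)"
  by (simp add: hermitian_def dagger_sum)

section \<open>Determinants, and the phase between unitary and special unitary matrices\<close>

lemma det_cscale: "det (cscale c (A :: complex^'n^'n)) = c ^ CARD('n) * det A"
proof -
  have "cscale c A = (\<chi> i. c *s A $ i)"
    by (simp add: cscale_def vec_eq_iff)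
  then show ?thesis
    by (simp add: det_rows_mul)
qed

lemma det_dagger: "det (dagger A) = cnj (det A)"
proof -
  have "det (dagger A) = det (transpose (dagger A))" by simp
  also have "\<dots> = cnj (det A)"
    by (simp add: det_def dagger_def transpose_def)
  finally show ?thesis .
qed

lemma unitary_cscale:
  assumes "unitary U" "norm c = 1"
  shows "unitary (cscale c U)"
proof -
  have "c * cnj c = 1"
    using assms(2) by (simp add: complex_norm_square[symmetric])
  with assms show ?thesis
    by (simp add: unitary_def dagger_cscale cscale_mult_left cscale_mult_right cscale_cscale
        mult.commute)
qed

text \<open>\<open>det U\<close> has modulus one, and \<open>c\<close> is a root of order
  \<open>CARD('n)\<close> of its inverse, because scaling by \<open>c\<close> multiplies the
  determinant by \<open>c ^ CARD('n)\<close>.\<close>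

lemma unitary_phase_SU:
  fixes U :: "complex^'n^'n"
  assumes "unitary U"
  obtains c where "norm c = 1" "cscale c U \<in> SU"
proof -
  have "det U * cnj (det U) = det (U ** dagger U)"
    by (simp add: det_mul det_dagger)
  also have "\<dots> = 1"
    using assms by (simp add: unitary_def)
  finally have *: "norm (det U) = 1"
    by (simp add: complex_norm_square[symmetric] flip: of_real_power)
      (simp add: power2_eq_1_iff; smt (verit) norm_ge_zero)
  then obtain \<phi> where \<phi>: "det U = cis \<phi>"
    using rcis_cmod_Arg[of "det U"] * by (metis rcis_def mult_1 of_real_1)
  define c where "c = cis (- \<phi> / CARD('n))"
  have "c ^ CARD('n) * det U = 1"
    unfolding c_def by (simp only: Complex.DeMoivre \<phi>) (simp add: cis_mult)
  moreover have "norm c = 1"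
    by (simp add: c_def)
  ultimately show ?thesis
    using that[of c] unitary_cscale[OF assms, of c]
    by (auto simp: SU_def unitary_def det_cscale)
qed

lemma cscale_conj:
  assumes "norm c = 1"
  shows "dagger (cscale c U) ** A ** cscale c U = dagger U ** A ** U"
    "cscale c U ** A ** dagger (cscale c U) = U ** A ** dagger U"
proof -
  have "c * cnj c = 1"
    using assms by (simp add: complex_norm_square[symmetric])
  then show "dagger (cscale c U) ** A ** cscale c U = dagger U ** A ** U"
    "cscale c U ** A ** dagger (cscale c U) = U ** A ** dagger U"
    by (simp_all add: dagger_cscale cscale_mult_left cscale_mult_right cscale_cscale mult.commute)
qed

text \<open>Change one outer factor at a time; the unitary factor that remains in each term does not
  affect the norm.\<close>

lemma norm_diff_conj_le:
  fixes A B X :: "complex^'n^'n"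
  assumes "unitary A" "unitary B" and K: "\<And>(A :: complex^'n^'n) (B :: complex^'n^'n). norm (A ** B) \<le> norm A * norm B * K"
  shows "norm (A ** X ** dagger A - B ** X ** dagger B) \<le> 2 * K * norm (A - B) * norm X"
proof -
  have eq: "A ** X ** dagger A - B ** X ** dagger B
      = (A - B) ** X ** dagger A + B ** (X ** dagger (A - B))"
    unfolding matrix_mult.diff_left matrix_mult.diff_right dagger_diff matrix_mul_assoc by simp
  have "norm (dagger (A - B)) = norm (A - B)"
    unfolding norm_eq_sqrt_inner inner_eq_trace dagger_dagger
    by (subst trace_mul_sym) (rule refl)
  then have "norm (B ** (X ** dagger (A - B))) \<le> norm X * norm (A - B) * K"
    using K[of X "dagger (A - B)"] by (simp add: norm_unitary_left[OF assms(2)])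
  moreover have "norm ((A - B) ** X ** dagger A) \<le> norm (A - B) * norm X * K"
    using K[of "A - B" X] assms(1) by (simp add: norm_unitary_right)
  ultimately show ?thesis
    unfolding eq
    using norm_triangle_ineq[of "(A - B) ** X ** dagger A" "B ** (X ** dagger (A - B))"]
    by (simp add: mult_ac)
qed

subsection \<open>The matrix exponential\<close>

lemma norm_mat_pow_le:
  fixes A :: "complex^'n^'n"
  assumes "K > 0" "\<And>(A :: complex^'n^'n) (B :: complex^'n^'n). norm (A ** B) \<le> norm A * norm B * K"
  shows "norm (mat_pow A k) \<le> (norm A * K) ^ k * norm (mat 1 :: complex^'n^'n)"
proof (induction k)
  case (Suc k)
  have "norm (mat_pow A (Suc k)) \<le> norm A * norm (mat_pow A k) * K"
    using assms(2) by simp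
  also have "\<dots> = norm A * K * norm (mat_pow A k)"
    by simp
  also have "\<dots> \<le> norm A * K * ((norm A * K) ^ k * norm (mat 1 :: complex^'n^'n))"
    using Suc assms(1) by (intro mult_left_mono) auto
  finally show ?case
    by (simp add: mult.assoc)
qed simp

lemma summable_mat_exp: "summable (\<lambda>k. (1 / fact k) *\<^sub>R mat_pow (A :: complex^'n^'n) k)"
proof -
  obtain K where K: "K > 0" "\<And>(A :: complex^'n^'n) (B :: complex^'n^'n). norm (A ** B) \<le> norm A * norm B * K"
    using norm_matrix_mult_le by blast
  have "norm ((1 / fact k) *\<^sub>R mat_pow A k)
      \<le> inverse (fact k) * (norm A * K) ^ k * norm (mat 1 :: complex^'n^'n)" for k
    using mult_left_mono[OF norm_mat_pow_le[OF K, of A k], of "inverse (fact k)"]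
    by (simp add: divide_inverse mult.assoc)
  then show ?thesis
    by (intro summable_comparison_test'[OF summable_mult2[OF summable_exp]])
qed

lemma mat_pow_commute: "mat_pow A k ** A = A ** mat_pow A k"
  by (induction k) (simp_all add: matrix_mul_assoc[symmetric])

lemma mat_pow_cscale: "mat_pow (cscale c A) k = cscale (c ^ k) (mat_pow A k)"
  by (induction k) (simp_all add: cscale_mult_left cscale_mult_right cscale_cscale mult.commute)

lemma mat_exp_commute: "mat_exp A ** A = A ** mat_exp A"
proof -
  have "mat_exp A ** A = (\<Sum>k. ((1 / fact k) *\<^sub>R mat_pow A k) ** A)"
    unfolding mat_exp_def
    by (rule bounded_linear.suminf[OF matrix_mult.bounded_linear_left summable_mat_exp])
  also have "\<dots> = (\<Sum>k. A ** ((1 / fact k) *\<^sub>R mat_pow A k))"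
    by (simp only: matrix_mult.scaleR_left matrix_mult.scaleR_right mat_pow_commute)
  also have "\<dots> = A ** mat_exp A"
    unfolding mat_exp_def
    by (rule bounded_linear.suminf[OF matrix_mult.bounded_linear_right summable_mat_exp, symmetric])
  finally show ?thesis .
qed

lemma mat_exp_0: "mat_exp (0 :: complex^'n^'n) = mat 1"
proof -
  have "mat_pow 0 k = 0" if "k \<noteq> 0" for k
    using that by (cases k) (simp_all add: matrix_mult.zero_left)
  then have "(\<lambda>k. (1 / fact k) *\<^sub>R mat_pow (0 :: complex^'n^'n) k) sums
      (\<Sum>k\<in>{0}. (1 / fact k) *\<^sub>R mat_pow 0 k)"
    by (intro sums_finite) auto
  then have "(\<Sum>k. (1 / fact k) *\<^sub>R mat_pow (0 :: complex^'n^'n) k) = mat 1"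
    by (simp add: sums_iff)
  then show ?thesis
    by (simp only: mat_exp_def)
qed

text \<open>Entrywise the exponential is an everywhere convergent power series in the scalar
  \<open>z\<close>, so that it can be differentiated termwise.\<close>

lemma mat_exp_entry:
  fixes A :: "complex^'n^'n"
  shows
  "mat_exp (cscale z A) $ i $ j = (\<Sum>k. (mat_pow A k $ i $ j / fact k) * z ^ k)"
  "summable (\<lambda>k. (mat_pow A k $ i $ j / fact k) * z ^ k)"
proof -
  have bl: "bounded_linear (\<lambda>B :: complex^'n^'n. B $ i $ j)"
    using bounded_linear_compose[OF bounded_linear_vec_nth bounded_linear_vec_nth] .
  have eq: "((1 / fact k) *\<^sub>R mat_pow (cscale z A) k) $ i $ j
      = (mat_pow A k $ i $ j / fact k) * z ^ k" for k
    by (simp add: mat_pow_cscale) (simp add: cscale_def scaleR_conv_of_real divide_inverse)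
  show "mat_exp (cscale z A) $ i $ j = (\<Sum>k. (mat_pow A k $ i $ j / fact k) * z ^ k)"
    unfolding mat_exp_def bounded_linear.suminf[OF bl summable_mat_exp] eq ..
  show "summable (\<lambda>k. (mat_pow A k $ i $ j / fact k) * z ^ k)"
    using bounded_linear.summable[OF bl summable_mat_exp[of "cscale z A"]] unfolding eq .
qed

lemma mat_exp_entry_DERIV:
  "((\<lambda>z. mat_exp (cscale z A) $ i $ j) has_field_derivative (A ** mat_exp (cscale z A)) $ i $ j) (at z)"
proof -
  have "((\<lambda>z. \<Sum>k. (mat_pow A k $ i $ j / fact k) * z ^ k) has_field_derivative
      (\<Sum>k. diffs (\<lambda>k. mat_pow A k $ i $ j / fact k) k * z ^ k)) (at z)"
    by (rule termdiffs_strong_converges_everywhere) (rule mat_exp_entry(2))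
  \<comment> \<open>Index shift in the derived series:
    \<open>Suc k / fact (Suc k) = 1 / fact k\<close>, while one factor \<open>A\<close> is split off
    the power.\<close>
  moreover have "diffs (\<lambda>k. mat_pow A k $ i $ j / fact k) k * z ^ k
      = (\<Sum>l\<in>UNIV. A $ i $ l * (mat_pow A k $ l $ j / fact k * z ^ k))" for k
  proof -
    have "diffs (\<lambda>k. mat_pow A k $ i $ j / fact k) k = (A ** mat_pow A k) $ i $ j / fact k"
      by (simp add: diffs_def fact_Suc del: of_nat_Suc)
    then show ?thesis
      by (simp add: matrix_matrix_mult_def sum_divide_distrib sum_distrib_right mult.assoc)
  qed
  moreover have "(\<Sum>k. \<Sum>l\<in>UNIV. A $ i $ l * (mat_pow A k $ l $ j / fact k * z ^ k))
      = (\<Sum>l\<in>UNIV. \<Sum>k. A $ i $ l * (mat_pow A k $ l $ j / fact k * z ^ k))"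
    by (rule suminf_sum) (intro summable_mult mat_exp_entry(2))
  moreover have "\<dots> = (A ** mat_exp (cscale z A)) $ i $ j"
    by (simp only: matrix_matrix_mult_def mat_exp_entry(1) suminf_mult[OF mat_exp_entry(2)] vec_lambda_beta)
  ultimately show ?thesis
    by (simp only: mat_exp_entry(1))
qed

definition evolution :: "complex^'n^'n \<Rightarrow> real \<Rightarrow> complex^'n^'n" where
  "evolution H x = mat_exp (cscale (- \<i> * complex_of_real x) H)"

lemma has_vector_derivative_vecI:
  fixes f :: "real \<Rightarrow> ('a::euclidean_space)^'n"
  assumes "\<And>i. ((\<lambda>x. f x $ i) has_vector_derivative f' $ i) (at a within S)"
  shows "(f has_vector_derivative f') (at a within S)"
  unfolding has_vector_derivative_def
proof (subst has_derivative_componentwise_within, rule ballI)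
  fix b :: "'a^'n" assume "b \<in> Basis"
  then obtain i u where "b = axis i u"
    unfolding Basis_vec_def by blast
  then show "((\<lambda>x. f x \<bullet> b) has_derivative (\<lambda>h. (h *\<^sub>R f') \<bullet> b)) (at a within S)"
    using has_derivative_inner_left[OF assms[of i, unfolded has_vector_derivative_def], of u]
    by (simp add: inner_axis)
qed

lemma evolution_derivative:
  "(evolution H has_vector_derivative cscale (- \<i>) H ** evolution H x) (at x within S)"
proof (intro has_vector_derivative_vecI)
  fix i j
  have "((\<lambda>x. (\<lambda>z. mat_exp (cscale z H) $ i $ j) ((- \<i>) * complex_of_real x)) has_vector_derivative
      (- \<i>) * (H ** evolution H x) $ i $ j) (at x within S)"
    unfolding evolution_def
    by (rule field_vector_diff_chain_within[unfolded o_def,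
          OF _ has_field_derivative_at_within[OF mat_exp_entry_DERIV]])
      (auto intro!: derivative_eq_intros)
  then show "((\<lambda>x. evolution H x $ i $ j) has_vector_derivative
      (cscale (- \<i>) H ** evolution H x) $ i $ j) (at x within S)"
    by (simp add: cscale_mult_left) (simp add: cscale_def evolution_def)
qed

lemma evolution_0: "evolution H 0 = mat 1"
  by (simp add: evolution_def mat_exp_0)

text \<open>The generator scaled by \<open>c\<close> commutes with its exponential; \<open>c\<close>
  can be cancelled except at \<open>x = 0\<close>, where the exponential is the identity.\<close>

lemma evolution_commute: "evolution H x ** H = H ** evolution H x"
proof (cases "x = 0")
  case False
  define c where "c = - \<i> * complex_of_real x"
  have "c \<noteq> 0"
    using False by (simp add: c_def)
  moreover have "cscale c (evolution H x ** H) = cscale c (H ** evolution H x)"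
    using mat_exp_commute[of "cscale c H"]
    by (simp only: cscale_mult_left cscale_mult_right evolution_def c_def)
  ultimately show ?thesis
    by (simp add: cscale_def vec_eq_iff)
qed (simp add: evolution_0)

text \<open>For Hermitian \<open>H\<close> the two terms of the derivative of
  \<open>dagger (evolution H x) ** evolution H x\<close> cancel, so this product keeps its value at
  \<open>0\<close>.\<close>

lemma unitary_evolution:
  assumes "hermitian H"
  shows "unitary (evolution H x)"
proof -
  have "((\<lambda>x. dagger (evolution H x) ** evolution H x) has_vector_derivative 0) (at x within UNIV)" for x
  proof -
    have "((\<lambda>x. dagger (evolution H x) ** evolution H x) has_vector_derivative
        dagger (evolution H x) ** (cscale (- \<i>) H ** evolution H x)
        + dagger (cscale (- \<i>) H ** evolution H x) ** evolution H x) (at x within UNIV)"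
      by (intro matrix_mult.has_vector_derivative evolution_derivative
          bounded_linear.has_vector_derivative[OF bounded_linear_dagger])
    also have "dagger (cscale (- \<i>) H ** evolution H x) = cscale \<i> (dagger (evolution H x) ** H)"
      using assms by (simp add: dagger_mult dagger_cscale hermitian_def cscale_mult_left cscale_mult_right)
    also have "dagger (evolution H x) ** (cscale (- \<i>) H ** evolution H x)
        + cscale \<i> (dagger (evolution H x) ** H) ** evolution H x = 0"
      by (simp add: cscale_mult_left cscale_mult_right matrix_mul_assoc)
        (simp add: cscale_def vec_eq_iff)
    finally show ?thesis .
  qed
  then obtain c where "\<And>x. dagger (evolution H x) ** evolution H x = c"
    using has_vector_derivative_zero_constant[of UNIV "\<lambda>x. dagger (evolution H x) ** evolution H x"]
    by auto
  moreover from this[of 0] have "c = mat 1"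
    by (simp add: evolution_0)
  ultimately have "dagger (evolution H x) ** evolution H x = mat 1"
    by simp
  then show ?thesis
    using matrix_left_right_inverse by (auto simp: unitary_def)
qed

text \<open>Mean value inequality: the derivative is \<open>H\<close> times a unitary up to a phase,
  hence has norm at most \<open>norm H\<close>.\<close>

lemma norm_evolution_diff_le:
  assumes "hermitian H"
  shows "norm (evolution H x - evolution H y) \<le> norm H * \<bar>x - y\<bar>"
proof -
  have "norm (cscale (- \<i>) A) \<le> norm A" for A :: "complex^'n^'n"
    by (simp add: cscale_def norm_vec_def norm_mult)
  then have "norm (cscale (- \<i>) H ** evolution H x) \<le> norm H" for x
    unfolding norm_unitary_right[OF unitary_evolution[OF assms]] .
  then have "onorm (\<lambda>h. h *\<^sub>R (cscale (- \<i>) H ** evolution H x)) \<le> norm H" for x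
    by (intro onorm_le) (simp add: mult_left_mono mult.commute)
  then have "norm (evolution H x - evolution H y) \<le> norm H * norm (x - y)"
    by (intro differentiable_bound[of UNIV _ "\<lambda>x h. h *\<^sub>R (cscale (- \<i>) H ** evolution H x)"])
      (use evolution_derivative in \<open>auto simp: has_vector_derivative_def\<close>)
  then show ?thesis by simp
qed

subsection \<open>The Haar measure\<close>

lemma SU_mult: "U \<in> SU \<Longrightarrow> V \<in> SU \<Longrightarrow> U ** V \<in> SU"
  using unitary_mult[of U V] by (auto simp: SU_def unitary_def det_mul)

lemma SU_dagger: "U \<in> SU \<Longrightarrow> dagger U \<in> SU"
  by (auto simp: SU_def det_dagger)

lemma norm_unitary:
  fixes U :: "complex^'n^'n"
  assumes "unitary U"
  shows "norm U = norm (mat 1 :: complex^'n^'n)"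
  using norm_unitary_left[OF assms, of "mat 1"] by simp

lemma continuous_dagger [continuous_intros]:
  "continuous_on S f \<Longrightarrow> continuous_on S (\<lambda>x. dagger (f x :: complex^'n^'n))"
  by (rule bounded_linear.continuous_on[OF bounded_linear_dagger])

lemma borel_measurable_matrix_mult [measurable (raw)]:
  fixes f g :: "'a \<Rightarrow> complex^'n^'n"
  assumes "f \<in> borel_measurable M" "g \<in> borel_measurable M"
  shows "(\<lambda>x. f x ** g x) \<in> borel_measurable M"
  using assms by (rule borel_measurable_continuous_Pair) (intro continuous_intros matrix_mult.continuous_on)

lemma borel_measurable_dagger [measurable (raw)]:
  fixes f :: "'a \<Rightarrow> complex^'n^'n"
  assumes "f \<in> borel_measurable M"
  shows "(\<lambda>x. dagger (f x)) \<in> borel_measurable M"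
  using assms by (rule borel_measurable_continuous_on[rotated]) (intro continuous_intros)

locale haar_measure =
  fixes \<mu> :: "(complex^'n^'n) measure"
  assumes haar: "haar_SU \<mu>"
begin

sublocale prob_space \<mu>
  using haar by (simp add: haar_SU_def)

lemma sets_haar: "sets \<mu> = sets (restrict_space borel SU)"
  using haar by (simp add: haar_SU_def)

lemma space_haar: "space \<mu> = SU"
  using sets_eq_imp_space_eq[OF sets_haar] by (simp add: space_restrict_space)

lemma borel_measurable_haar: "f \<in> borel_measurable borel \<Longrightarrow> f \<in> measurable \<mu> borel"
  unfolding measurable_cong_sets[OF sets_haar refl] by (rule measurable_restrict_space1)

lemma measurable_id_haar [measurable]: "(\<lambda>U. U) \<in> borel_measurable \<mu>"
  by (rule borel_measurable_haar) simp

lemma measurable_mult_haar: "V \<in> SU \<Longrightarrow> (\<lambda>U. V ** U) \<in> measurable \<mu> \<mu>"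
  unfolding measurable_cong_sets[OF sets_haar sets_haar]
  by (rule measurable_restrict_space3) (auto simp: SU_mult)

text \<open>All unitaries have the norm of \<open>mat 1\<close>, so \<open>SU\<close> lies in a
  closed ball, which is compact.\<close>

lemma bounded_on_SU:
  fixes f :: "complex^'n^'n \<Rightarrow> 'b::real_normed_vector"
  assumes "continuous_on UNIV f"
  obtains B where "\<And>U. U \<in> SU \<Longrightarrow> norm (f U) \<le> B"
proof -
  have "compact (f ` cball 0 (norm (mat 1 :: complex^'n^'n)))"
    by (intro compact_continuous_image continuous_on_subset[OF assms]) auto
  then obtain B where "\<And>x. x \<in> f ` cball 0 (norm (mat 1 :: complex^'n^'n)) \<Longrightarrow> norm x \<le> B"
    using compact_imp_bounded bounded_iff by metis
  then show ?thesis
    by (intro that[of B]) (use norm_unitary[OF unitary_SU] in force)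
qed

lemma integrable_continuous:
  fixes f :: "complex^'n^'n \<Rightarrow> 'b::{banach,second_countable_topology}"
  assumes "continuous_on UNIV f"
  shows "integrable \<mu> f"
proof -
  obtain B where "\<And>U. U \<in> SU \<Longrightarrow> norm (f U) \<le> B"
    using bounded_on_SU[OF assms] by blast
  then show ?thesis
    by (intro integrable_const_bound[where B = B] borel_measurable_haar
        borel_measurable_continuous_onI assms AE_I2) (auto simp: space_haar)
qed

lemma integral_mult_left:
  fixes f :: "complex^'n^'n \<Rightarrow> 'b::{banach,second_countable_topology}"
  assumes "continuous_on UNIV f" "V \<in> SU"
  shows "(\<integral>U. f (V ** U) \<partial>\<mu>) = integral\<^sup>L \<mu> f"
proof -
  have "integral\<^sup>L \<mu> f = integral\<^sup>L (distr \<mu> \<mu> (\<lambda>U. V ** U)) f"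
    using haar assms(2) by (simp add: haar_SU_def)
  also have "\<dots> = (\<integral>U. f (V ** U) \<partial>\<mu>)"
    by (intro integral_distr measurable_mult_haar assms borel_measurable_haar
        borel_measurable_continuous_onI)
  finally show ?thesis by simp
qed

text \<open>Integrate \<open>f (y\<^sup>\<dagger> x)\<close> over both variables: left invariance in \<open>x\<close> gives
  \<open>\<integral> f\<close>, left invariance in \<open>y\<close> gives \<open>\<integral> f (y\<^sup>\<dagger>)\<close>.\<close>

lemma integral_dagger:
  fixes f :: "complex^'n^'n \<Rightarrow> 'b::{banach,second_countable_topology}"
  assumes f: "continuous_on UNIV f"
  shows "(\<integral>U. f (dagger U) \<partial>\<mu>) = integral\<^sup>L \<mu> f"
proof -
  interpret pair: pair_prob_space \<mu> \<mu> ..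
  have [measurable]: "f \<in> borel_measurable borel"
    by (rule borel_measurable_continuous_onI[OF f])
  obtain B where B: "\<And>U. U \<in> SU \<Longrightarrow> norm (f U) \<le> B"
    using bounded_on_SU[OF f] by blast
  have "integrable (\<mu> \<Otimes>\<^sub>M \<mu>) (\<lambda>(x, y). f (dagger y ** x))"
    by (intro pair.P.integrable_const_bound[where B = B] AE_I2)
      (auto simp: space_pair_measure space_haar intro!: B SU_mult SU_dagger)
  then have "(\<integral>y. (\<integral>x. f (dagger y ** x) \<partial>\<mu>) \<partial>\<mu>) = (\<integral>x. (\<integral>y. f (dagger y ** x) \<partial>\<mu>) \<partial>\<mu>)"
    by (rule pair.Fubini_integral)
  also have "(\<integral>y. (\<integral>x. f (dagger y ** x) \<partial>\<mu>) \<partial>\<mu>) = (\<integral>y. integral\<^sup>L \<mu> f \<partial>\<mu>)"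
    by (intro Bochner_Integration.integral_cong refl integral_mult_left f)
      (simp add: space_haar SU_dagger)
  also have "(\<integral>x. (\<integral>y. f (dagger y ** x) \<partial>\<mu>) \<partial>\<mu>) = (\<integral>x. (\<integral>y. f (dagger y) \<partial>\<mu>) \<partial>\<mu>)"
  proof (rule Bochner_Integration.integral_cong[OF refl])
    fix x assume "x \<in> space \<mu>"
    then have "(\<integral>y. f (dagger (dagger x ** y)) \<partial>\<mu>) = (\<integral>y. f (dagger y) \<partial>\<mu>)"
      by (intro integral_mult_left) (auto simp: space_haar SU_dagger intro!: continuous_intros
          continuous_on_compose2[OF f])
    then show "(\<integral>y. f (dagger y ** x) \<partial>\<mu>) = (\<integral>y. f (dagger y) \<partial>\<mu>)"
      by (simp add: dagger_mult)
  qed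
  finally show ?thesis
    by (simp add: prob_space)
qed

text \<open>Inversion, which preserves integrals by \<open>integral_dagger\<close>, turns right
  multiplication by \<open>V\<close> into left multiplication by \<open>dagger V\<close>.\<close>

lemma integral_mult_right:
  fixes f :: "complex^'n^'n \<Rightarrow> 'b::{banach,second_countable_topology}"
  assumes f: "continuous_on UNIV f" and "V \<in> SU"
  shows "(\<integral>U. f (U ** V) \<partial>\<mu>) = integral\<^sup>L \<mu> f"
proof -
  have "(\<integral>U. f (U ** V) \<partial>\<mu>) = (\<integral>U. f (dagger U ** V) \<partial>\<mu>)"
    by (rule integral_dagger[symmetric])
      (intro continuous_on_compose2[OF f] matrix_mult.continuous_on continuous_intros; simp)
  also have "\<dots> = (\<integral>U. f (dagger (dagger V ** U)) \<partial>\<mu>)"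
    by (simp add: dagger_mult)
  also have "\<dots> = (\<integral>U. f (dagger U) \<partial>\<mu>)"
    by (intro integral_mult_left SU_dagger assms) (auto intro!: continuous_intros continuous_on_compose2[OF f])
  also have "\<dots> = integral\<^sup>L \<mu> f"
    by (rule integral_dagger[OF f])
  finally show ?thesis .
qed

text \<open>Conjugation forgets the phase, so that \<open>V\<close> need not have determinant \<open>1\<close>.\<close>

lemma integral_conj_mult_right:
  fixes g :: "complex^'n^'n \<Rightarrow> 'b::{banach,second_countable_topology}"
  assumes g: "continuous_on UNIV g" and V: "unitary V"
  shows "(\<integral>U. g (dagger (U ** V) ** A ** (U ** V)) \<partial>\<mu>) = (\<integral>U. g (dagger U ** A ** U) \<partial>\<mu>)"
proof -
  obtain c where c: "norm c = 1" "cscale c V \<in> SU"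
    using unitary_phase_SU[OF V] by blast
  have "(\<integral>U. g (dagger (U ** V) ** A ** (U ** V)) \<partial>\<mu>)
      = (\<integral>U. g (dagger (U ** cscale c V) ** A ** (U ** cscale c V)) \<partial>\<mu>)"
    by (simp add: cscale_mult_right[of _ c V] cscale_conj[OF c(1)])
  also have "\<dots> = (\<integral>U. g (dagger U ** A ** U) \<partial>\<mu>)"
    by (intro integral_mult_right[where f = "\<lambda>U. g (dagger U ** A ** U)"] c(2)
        continuous_on_compose2[OF g] matrix_mult.continuous_on continuous_intros) simp
  finally show ?thesis .
qed

end

subsection \<open>Second moments of a randomly conjugated matrix\<close>

text \<open>Diagonal matrices and Hadamard matrices in a coordinate plane are all that is needed of the
  unitary group to determine the second moments; both have the following shape.\<close>

definition two_entry :: "('n \<Rightarrow> complex) \<Rightarrow> ('n \<Rightarrow> complex) \<Rightarrow> ('n \<Rightarrow> 'n) \<Rightarrow> complex^'n^'n" where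
  "two_entry u v \<sigma> = (\<chi> i a. (if i = a then u a else 0) + (if i = \<sigma> a then v a else 0))"

text \<open>Column \<open>a\<close> consists of \<open>u a\<close> in row \<open>a\<close> plus
  \<open>v a\<close> in row \<open>\<sigma> a\<close>, so each entry of the conjugate involves only
  four entries of \<open>G\<close>.\<close>

lemma two_entry_conj:
  "(dagger (two_entry u v \<sigma>) ** G ** two_entry u v \<sigma>) $ a $ b
    = cnj (u a) * u b * G $ a $ b + cnj (u a) * v b * G $ a $ \<sigma> b
      + cnj (v a) * u b * G $ \<sigma> a $ b + cnj (v a) * v b * G $ \<sigma> a $ \<sigma> b"
  by (simp add: matrix_matrix_mult_def dagger_def two_entry_def ring_distribs sum.distrib
      if_distrib[of cnj] if_distribR if_distrib[of "\<lambda>x. x * _"] if_distrib[of "\<lambda>x. _ * x"] mult_ac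
      cong: if_cong)

lemma unitary_diagonal:
  assumes "\<And>a. norm (u a) = 1"
  shows "unitary (two_entry u (\<lambda>_. 0) id)"
proof -
  have "cnj (u a) * u a = 1" for a
    using assms[of a] by (simp add: complex_norm_square[symmetric] mult.commute)
  then have "dagger (two_entry u (\<lambda>_. 0) id) ** mat 1 ** two_entry u (\<lambda>_. 0) id = mat 1"
    unfolding vec_eq_iff two_entry_conj by (auto simp: mat_def)
  then show ?thesis
    using matrix_left_right_inverse by (auto simp: unitary_def)
qed

text \<open>In the plane of the coordinates \<open>p\<close> and \<open>q\<close> this is the
  reflection with rows (1, 1) and (1, -1), divided by the square root of 2; elsewhere it is the
  identity.\<close>

definition hadamard :: "'n \<Rightarrow> 'n \<Rightarrow> complex^'n^'n" where
  "hadamard p q = (let s = complex_of_real (1 / sqrt 2) in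
     two_entry (\<lambda>a. if a = p then s else if a = q then - s else 1)
       (\<lambda>a. if a = p \<or> a = q then s else 0) (Transposition.transpose p q))"

lemma inverse_sqrt_2_mult: "complex_of_real (1 / sqrt 2) * complex_of_real (1 / sqrt 2) = 1 / 2"
  by (simp flip: of_real_mult)

lemma unitary_hadamard:
  assumes "p \<noteq> q"
  shows "unitary (hadamard p q)"
proof -
  have "dagger (hadamard p q) ** mat 1 ** hadamard p q = mat 1"
    using assms inverse_sqrt_2_mult unfolding vec_eq_iff hadamard_def Let_def two_entry_conj
    by (auto simp: mat_def Transposition.transpose_def)
  then show ?thesis
    using matrix_left_right_inverse by (auto simp: unitary_def)
qed

lemma hadamard_conj:
  fixes G :: "complex^'n^'n"
  assumes "p \<noteq> q"
  defines "G' \<equiv> dagger (hadamard p q) ** G ** hadamard p q"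
  shows "G' $ p $ p = (G $ p $ p + G $ p $ q + G $ q $ p + G $ q $ q) / 2"
    and "r \<noteq> p \<Longrightarrow> r \<noteq> q \<Longrightarrow> G' $ r $ r = G $ r $ r"
  using assms(1) inverse_sqrt_2_mult unfolding G'_def hadamard_def Let_def two_entry_conj
  by (auto simp: Transposition.transpose_def)

section \<open>Second moments of the entries under the Haar measure\<close>

context haar_measure
begin

text \<open>No complex conjugate appears: for Hermitian matrices the inner product with
  \<open>X\<close> is the trace of a product, and its square expands into plain products of
  entries.\<close>

definition moment :: "complex^'n^'n \<Rightarrow> 'n \<Rightarrow> 'n \<Rightarrow> 'n \<Rightarrow> 'n \<Rightarrow> complex" where
  "moment A a b c e = (\<integral>U. (dagger U ** A ** U) $ a $ b * (dagger U ** A ** U) $ c $ e \<partial>\<mu>)"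

lemma integrable_moment:
  "integrable \<mu> (\<lambda>U. (dagger U ** A ** U) $ a $ b * (dagger U ** A ** U) $ c $ e)"
  by (intro integrable_continuous continuous_intros matrix_mult.continuous_on)

text \<open>By right invariance, conjugation by \<open>V\<close> preserves the law of
  \<open>dagger U ** A ** U\<close>. Special choices of \<open>V\<close> turn this into linear
  relations between moments.\<close>

lemma moment_conj:
  assumes "unitary V"
  shows "moment A a b c e = (\<integral>U. (dagger V ** (dagger U ** A ** U) ** V) $ a $ b
     * (dagger V ** (dagger U ** A ** U) ** V) $ c $ e \<partial>\<mu>)"
proof -
  have "(\<integral>U. (dagger (U ** V) ** A ** (U ** V)) $ a $ b * (dagger (U ** V) ** A ** (U ** V)) $ c $ e \<partial>\<mu>)
      = moment A a b c e"
    unfolding moment_def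
    by (rule integral_conj_mult_right[where g = "\<lambda>G. G $ a $ b * G $ c $ e"])
      (intro continuous_intros assms)+
  then show ?thesis
    by (simp add: dagger_mult matrix_mul_assoc)
qed

lemma moment_commute: "moment A c e a b = moment A a b c e"
  by (simp add: moment_def mult.commute)

text \<open>Conjugation by the diagonal matrix with a single entry \<open>\<i>\<close>, at \<open>x\<close>, multiplies the
  moment by a power of \<open>\<i>\<close> with nonzero exponent in \<open>{-2..2}\<close>.\<close>

lemma moment_eq_0:
  assumes "\<not> (a = b \<and> c = e)" "\<not> (a = e \<and> b = c)"
  shows "moment A a b c e = 0"
proof -
  define u where "u x i = (if i = x then \<i> else 1)" for x i :: 'n
  have *: "moment A a b c e = cnj (u x a) * u x b * (cnj (u x c) * u x e) * moment A a b c e" for x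
  proof -
    have u: "unitary (two_entry (u x) (\<lambda>_. 0) id)"
      by (rule unitary_diagonal) (simp add: u_def)
    have "moment A a b c e = (\<integral>U. cnj (u x a) * u x b * (cnj (u x c) * u x e)
        * ((dagger U ** A ** U) $ a $ b * (dagger U ** A ** U) $ c $ e) \<partial>\<mu>)"
      using moment_conj[OF u, of A a b c e] unfolding two_entry_conj by (simp add: mult_ac)
    then show ?thesis
      by (simp only: moment_def integral_mult_right_zero)
  qed
  \<comment> \<open>The factor is not 1 if \<open>x\<close> occurs a different number of times among
    the row indices \<open>a, c\<close> than among the column indices \<open>b, e\<close>. Outside
    the two excluded pairings such an \<open>x\<close> exists.\<close>
  show ?thesis
    using assms *[of a] *[of b] *[of c] *[of e]
    by (auto simp: u_def split: if_splits)
qed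

text \<open>Invariance under the Hadamard matrix at \<open>p, q\<close>. The relation for
  \<open>moment A p p p p\<close> has a right-hand side symmetric in \<open>p\<close> and
  \<open>q\<close>, which gives the second claim and then the first; the third compares the products
  with an untouched entry at \<open>r\<close>.\<close>

lemma moment_diag:
  assumes "p \<noteq> q"
  shows "moment A p p p p = moment A p p q q + moment A p q q p"
    and "moment A q q q q = moment A p p p p"
    and "r \<noteq> p \<Longrightarrow> r \<noteq> q \<Longrightarrow> moment A p p r r = moment A q q r r"
proof -
  define g where "g U a b = (dagger U ** A ** U) $ a $ b" for U a b
  have int: "integrable \<mu> (\<lambda>U. g U a b * g U c e)"
    and moment_g: "moment A a b c e = (\<integral>U. g U a b * g U c e \<partial>\<mu>)" for a b c e
    unfolding g_def moment_def by (rule integrable_moment refl)+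
  have *: "4 * moment A p p p p = moment A p p p p + moment A q q q q
      + 2 * moment A p p q q + 2 * moment A p q q p" if "p \<noteq> q" for p q
  proof -
    \<comment> \<open>Of these sixteen moments only six survive \<open>moment_eq_0\<close>: those
      whose row indices are a rearrangement of the column indices.\<close>
    define s where "s = moment A p p p p + moment A p p p q + moment A p p q p + moment A p p q q
       + (moment A p q p p + moment A p q p q + moment A p q q p + moment A p q q q)
       + (moment A q p p p + moment A q p p q + moment A q p q p + moment A q p q q)
       + (moment A q q p p + moment A q q p q + moment A q q q p + moment A q q q q)"
    have "moment A p p p p = (\<integral>U. (g U p p + g U p q + g U q p + g U q q) / 2
        * ((g U p p + g U p q + g U q p + g U q q) / 2) \<partial>\<mu>)"
      using moment_conj[OF unitary_hadamard[OF that], of A p p p p]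
      unfolding hadamard_conj(1)[OF that] g_def .
    also have "\<dots> = s / 4"
      by (simp add: s_def moment_g ring_distribs int add_divide_distrib) (simp add: mult.commute)
    finally have "4 * moment A p p p p = s"
      by (simp add: mult.commute)
    with that show ?thesis
      by (simp add: s_def moment_eq_0 moment_commute[of A q q p p] moment_commute[of A q p p q])
  qed
  have **: "moment A q p p q = moment A p q q p" "moment A q q p p = moment A p p q q"
    by (rule moment_commute)+
  show eq: "moment A q q q q = moment A p p p p"
    using *[OF assms] *[OF assms[symmetric]] unfolding ** by algebra
  show "moment A p p p p = moment A p p q q + moment A p q q p"
    using *[OF assms] unfolding eq by algebra
  show "moment A p p r r = moment A q q r r" if "r \<noteq> p" "r \<noteq> q"
  proof -
    define s where "s = moment A p p r r + moment A p q r r + moment A q p r r + moment A q q r r"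
    have "moment A p p r r = (\<integral>U. (g U p p + g U p q + g U q p + g U q q) / 2 * g U r r \<partial>\<mu>)"
      using moment_conj[OF unitary_hadamard[OF assms], of A p p r r]
      unfolding hadamard_conj(1)[OF assms] hadamard_conj(2)[OF assms that] g_def .
    also have "\<dots> = s / 2"
      by (simp add: s_def moment_g ring_distribs int add_divide_distrib)
    finally have "2 * moment A p p r r = s"
      by (simp add: mult.commute)
    with assms that show ?thesis
      by (simp add: s_def moment_eq_0)
  qed
qed

text \<open>The relations of \<open>moment_diag\<close> connect all index pairs, so one value
  \<beta> and one value \<gamma> remain. Where both pairings hold the moment is \<beta> + \<gamma>,
  so that the two cases simply add up.\<close>

lemma moment_structure:
  assumes "CARD('n) \<ge> 2"
  obtains \<beta> \<gamma> where "\<And>a b c e. moment A a b c e =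
    (if a = b \<and> c = e then \<beta> else 0) + (if a = e \<and> b = c then \<gamma> else 0)"
proof -
  obtain p q :: 'n where "p \<noteq> q"
    using assms by (metis (full_types) UNIV_I card_2_iff' ex_card)
  define \<beta> \<gamma> where "\<beta> = moment A p p q q" and "\<gamma> = moment A p q q p"
  have \<alpha>: "moment A a a a a = moment A b b b b" for a b
    by (metis moment_diag(2))
  have \<beta>1: "moment A a a b b = moment A c c b b" if "a \<noteq> b" "c \<noteq> b" for a b c
    using moment_diag(3)[of a c b] that by metis
  have \<beta>: "moment A a a b b = \<beta>" if "a \<noteq> b" for a b
    unfolding \<beta>_def using \<beta>1 that \<open>p \<noteq> q\<close> by (metis moment_commute)
  have \<alpha>': "moment A a a a a = \<beta> + \<gamma>" for a
    using moment_diag(1)[OF \<open>p \<noteq> q\<close>, of A] \<alpha>[of a p] by (simp add: \<beta>_def \<gamma>_def)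
  have \<gamma>: "moment A a b b a = \<gamma>" if "a \<noteq> b" for a b
    using moment_diag(1)[OF that, of A] \<beta>[OF that] \<alpha>'[of a] by simp
  show ?thesis
  proof (rule that)
    fix a b c e
    show "moment A a b c e = (if a = b \<and> c = e then \<beta> else 0) + (if a = e \<and> b = c then \<gamma> else 0)"
    proof (cases "a = b \<and> c = e")
      case True
      then have "b = a" "e = c" by auto
      then show ?thesis
        using \<alpha>'[of a] \<beta>[of a c] by (cases "a = c") auto
    next
      case F: False
      show ?thesis
      proof (cases "a = e \<and> b = c")
        case True
        then have "e = a" "c = b" by auto
        with F show ?thesis
          using \<gamma>[of a b] by auto
      next
        case False
        then show ?thesis
          unfolding moment_eq_0[OF F False] if_not_P[OF F] if_not_P[OF False] by simp
      qed
    qed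
  qed
qed

text \<open>\<beta> and \<gamma> are determined by two invariants of the conjugates of
  \<open>A\<close>: their trace is 0 and the trace of their square is
  \<open>(norm A)\<^sup>2\<close>. Contracting with \<open>X\<close> then leaves only the \<gamma>
  term, because \<open>trace X = 0\<close>.\<close>

theorem second_moment:
  fixes A X :: "complex^'n^'n"
  assumes A: "hermitian A" "trace A = 0" and X: "hermitian X" "trace X = 0"
    and card: "CARD('n) \<ge> 2"
  shows "(\<integral>U. ((dagger U ** A ** U) \<bullet> X)\<^sup>2 \<partial>\<mu>) = (norm A)\<^sup>2 * (norm X)\<^sup>2 / ((real CARD('n))\<^sup>2 - 1)"
proof -
  let ?d = "of_nat CARD('n) :: complex"
  define G where "G U = dagger U ** A ** U" for U
  obtain \<beta> \<gamma> where m: "\<And>a b c e. moment A a b c e =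
    (if a = b \<and> c = e then \<beta> else 0) + (if a = e \<and> b = c then \<gamma> else 0)"
    using moment_structure[OF card] by blast
  have G: "unitary U \<Longrightarrow> trace (G U) = 0" "hermitian (G U)" "unitary U \<Longrightarrow> norm (G U) = norm A" for U
    using trace_conj[of "dagger U" A] A
    by (simp_all add: G_def hermitian_conj' norm_conj)
  have int: "integrable \<mu> (\<lambda>U. G U $ a $ b * G U $ c $ e)" for a b c e
    unfolding G_def by (rule integrable_moment)
  have mG: "moment A a b c e = (\<integral>U. G U $ a $ b * G U $ c $ e \<partial>\<mu>)" for a b c e
    by (simp add: moment_def G_def)
  have sq: "complex_of_real (B \<bullet> C) = trace (B ** C)" if "hermitian B" "hermitian C" for B C :: "complex^'n^'n"
    using trace_hermitian_mult_real[OF that] that by (simp add: inner_hermitian complex_eq_iff)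
  \<comment> \<open>First equation: the mean of one diagonal entry times the trace, for an arbitrary
    \<open>a\<close>.\<close>
  have "?d * \<beta> + \<gamma> = 0"
  proof -
    fix a :: 'n
    have "(\<Sum>c\<in>UNIV. moment A a a c c) = (\<integral>U. G U $ a $ a * trace (G U) \<partial>\<mu>)"
      by (simp add: mG int sum_distrib_left trace_def Bochner_Integration.integral_sum)
    also have "\<dots> = (\<integral>U. 0 \<partial>\<mu>)"
      by (intro Bochner_Integration.integral_cong) (auto simp: G space_haar unitary_SU)
    finally show ?thesis
      by (simp add: m sum.distrib)
  qed
  \<comment> \<open>Second equation: the mean of the trace of the square.\<close>
  moreover have "?d * \<beta> + ?d * ?d * \<gamma> = complex_of_real ((norm A)\<^sup>2)"
  proof -
    have "(\<Sum>a\<in>UNIV. \<Sum>b\<in>UNIV. moment A a b b a) = (\<integral>U. trace (G U ** G U) \<partial>\<mu>)"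
      by (simp add: mG int trace_def matrix_matrix_mult_def Bochner_Integration.integral_sum)
    also have "\<dots> = (\<integral>U. complex_of_real ((norm A)\<^sup>2) \<partial>\<mu>)"
    proof (intro Bochner_Integration.integral_cong refl)
      fix U assume "U \<in> space \<mu>"
      then have "norm (G U) = norm A"
        by (simp add: G space_haar unitary_SU)
      then show "trace (G U ** G U) = complex_of_real ((norm A)\<^sup>2)"
        unfolding power2_norm_eq_inner[symmetric] sq[OF G(2) G(2), symmetric] by simp
    qed
    finally show ?thesis
      by (simp add: m sum.distrib prob_space mult.assoc eq_commute[of _ "_ :: 'n"] distrib_left cong: conj_cong)
  qed
  ultimately have "(?d\<^sup>2 - 1) * \<gamma> = complex_of_real ((norm A)\<^sup>2)"
    by (simp only: add_eq_0_iff2 left_diff_distrib power2_eq_square mult_1_left) (simp add: mult.assoc)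
  moreover have "complex_of_real (\<integral>U. (G U \<bullet> X)\<^sup>2 \<partial>\<mu>) = \<gamma> * complex_of_real ((norm X)\<^sup>2)"
  proof -
    have "complex_of_real ((G U \<bullet> X)\<^sup>2) = (\<Sum>a\<in>UNIV. \<Sum>b\<in>UNIV. \<Sum>c\<in>UNIV. \<Sum>e\<in>UNIV.
        X $ b $ a * X $ e $ c * (G U $ a $ b * G U $ c $ e))" for U
    proof -
      define T where "T = (\<Sum>a\<in>UNIV. \<Sum>b\<in>UNIV. G U $ a $ b * X $ b $ a)"
      have "complex_of_real ((G U \<bullet> X)\<^sup>2) = T * T"
        by (simp add: sq G X power2_eq_square T_def trace_def matrix_matrix_mult_def)
      also have "\<dots> = (\<Sum>a\<in>UNIV. \<Sum>b\<in>UNIV. G U $ a $ b * X $ b $ a * T)"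
        by (subst (1) T_def) (simp only: sum_distrib_right)
      finally show ?thesis
        by (simp add: T_def sum_distrib_left mult_ac)
    qed
    then have "(\<integral>U. complex_of_real ((G U \<bullet> X)\<^sup>2) \<partial>\<mu>) = (\<Sum>a\<in>UNIV. \<Sum>b\<in>UNIV. \<Sum>c\<in>UNIV. \<Sum>e\<in>UNIV.
        X $ b $ a * X $ e $ c * moment A a b c e)"
      by (simp add: Bochner_Integration.integral_sum int mG)
    also have "\<dots> = \<beta> * (trace X)\<^sup>2 + \<gamma> * trace (X ** X)"
    proof -
      have "(\<Sum>c\<in>UNIV. \<Sum>e\<in>UNIV. X $ b $ a * X $ e $ c * moment A a b c e)
          = (if b = a then X $ b $ a * \<beta> * trace X else 0) + X $ b $ a * X $ a $ b * \<gamma>" for a b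
      proof -
        have "X $ b $ a * X $ e $ c * moment A a b c e
            = (if e = c then if b = a then X $ b $ a * \<beta> * X $ c $ c else 0 else 0)
              + (if e = a then if c = b then X $ b $ a * X $ a $ b * \<gamma> else 0 else 0)" for c e
          unfolding m by (auto simp: ring_distribs)
        then show ?thesis
          by (simp add: sum.distrib trace_def sum_distrib_left)
      qed
      then have "(\<Sum>a\<in>UNIV. \<Sum>b\<in>UNIV. \<Sum>c\<in>UNIV. \<Sum>e\<in>UNIV. X $ b $ a * X $ e $ c * moment A a b c e)
          = (\<Sum>a\<in>UNIV. X $ a $ a * \<beta> * trace X) + (\<Sum>a\<in>UNIV. \<Sum>b\<in>UNIV. X $ b $ a * X $ a $ b * \<gamma>)"
        by (simp add: sum.distrib)
      moreover have "(\<Sum>a\<in>UNIV. X $ a $ a * \<beta> * trace X) = \<beta> * (trace X)\<^sup>2"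
        by (simp only: sum_distrib_right[symmetric] trace_def[symmetric])
          (simp add: power2_eq_square)
      moreover have "(\<Sum>a\<in>UNIV. \<Sum>b\<in>UNIV. X $ b $ a * X $ a $ b * \<gamma>) = \<gamma> * trace (X ** X)"
        by (simp add: trace_def matrix_matrix_mult_def sum_distrib_left mult_ac)
      ultimately show ?thesis by simp
    qed
    also have "\<dots> = \<gamma> * complex_of_real ((norm X)\<^sup>2)"
      using X by (simp add: power2_norm_eq_inner sq)
    finally show ?thesis
      by (simp only: integral_complex_of_real)
  qed
  ultimately have "complex_of_real (((real CARD('n))\<^sup>2 - 1) * (\<integral>U. (G U \<bullet> X)\<^sup>2 \<partial>\<mu>))
      = complex_of_real ((norm A)\<^sup>2 * (norm X)\<^sup>2)"
    by (simp only: of_real_mult of_real_diff of_real_power of_real_of_nat_eq of_real_1 mult.assoc[symmetric])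
  then have "((real CARD('n))\<^sup>2 - 1) * (\<integral>U. (G U \<bullet> X)\<^sup>2 \<partial>\<mu>) = (norm A)\<^sup>2 * (norm X)\<^sup>2"
    unfolding of_real_eq_iff .
  moreover have "(real CARD('n))\<^sup>2 - 1 > 0"
    using card by (simp add: one_less_power)
  ultimately show ?thesis
    unfolding G_def by (simp add: field_simps)
qed

end

subsection \<open>Concentration\<close>

text \<open>Index shift: \<open>direction U H k \<theta>\<close> belongs to the parameter
  \<open>\<theta>\<^sub>k\<^sub>+\<^sub>1\<close>; the derivative of the ansatz with respect to it is \<open>-\<i>\<close> times the
  ansatz times this direction.\<close>

definition direction ::
  "(nat \<Rightarrow> complex^'n^'n) \<Rightarrow> complex^'n^'n \<Rightarrow> nat \<Rightarrow> (nat \<Rightarrow> real) \<Rightarrow> complex^'n^'n" where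
  "direction U H k \<theta> = dagger (ansatz U H k \<theta>) ** H ** ansatz U H k \<theta>"

lemma ansatz_Suc: "ansatz U H (Suc k) \<theta> = U (Suc k) ** evolution H (\<theta> (Suc k)) ** ansatz U H k \<theta>"
  by (simp add: evolution_def)

lemma ansatz_cong:
  assumes "\<And>j. j \<le> k \<Longrightarrow> U j = U' j" "\<And>j. j \<in> {1..k} \<Longrightarrow> \<theta> j = \<theta>' j"
  shows "ansatz U H k \<theta> = ansatz U' H k \<theta>'"
  using assms by (induction k) (simp_all del: ansatz.simps(2) add: ansatz_Suc)

lemma unitary_ansatz:
  assumes "hermitian H" "\<And>j. j \<le> k \<Longrightarrow> unitary (U j)"
  shows "unitary (ansatz U H k \<theta>)"
  using assms(2)
  by (induction k) (simp_all del: ansatz.simps(2) add: ansatz_Suc unitary_mult unitary_evolution[OF assms(1)])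

lemma norm_direction:
  assumes "hermitian H" "\<And>j. j \<le> k \<Longrightarrow> unitary (U j)"
  shows "norm (direction U H k \<theta>) = norm H"
  using unitary_ansatz[OF assms, where \<theta> = \<theta>] by (simp add: direction_def norm_conj)

context haar_measure
begin

lemma prob_space_iid_law: "prob_space (iid_law \<mu> p)"
  unfolding iid_law_def by (intro prob_space_PiM prob_space_axioms)

lemma space_iid_law: "U \<in> space (iid_law \<mu> p) \<Longrightarrow> k \<le> p \<Longrightarrow> U k \<in> SU"
  by (auto simp: iid_law_def space_PiM space_haar)

lemma borel_measurable_component:
  "k \<in> I \<Longrightarrow> (\<lambda>U. U k) \<in> borel_measurable (Pi\<^sub>M I (\<lambda>_. \<mu>))"
  using measurable_compose[OF measurable_component_singleton[of k I "\<lambda>_. \<mu>"] measurable_id_haar] by simp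

lemma borel_measurable_ansatz:
  "(\<And>j. j \<le> k \<Longrightarrow> j \<in> I) \<Longrightarrow> (\<lambda>U. ansatz U H k \<theta>) \<in> borel_measurable (Pi\<^sub>M I (\<lambda>_. \<mu>))"
  by (induction k) (auto intro!: borel_measurable_component borel_measurable_matrix_mult)

lemma borel_measurable_direction:
  assumes "\<And>j. j \<le> k \<Longrightarrow> j \<in> I"
  shows "(\<lambda>U. direction U H k \<theta>) \<in> borel_measurable (Pi\<^sub>M I (\<lambda>_. \<mu>))"
  unfolding direction_def
  by (intro borel_measurable_matrix_mult borel_measurable_dagger borel_measurable_ansatz assms
      borel_measurable_const)

context
  fixes H :: "complex^'n^'n" and g :: "complex^'n^'n \<Rightarrow> real" and C :: real and p :: nat
    and \<theta> :: "nat \<Rightarrow> real"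
  assumes H: "hermitian H"
    and g: "continuous_on UNIV g"
    and g_le: "\<And>G. norm G = norm H \<Longrightarrow> \<bar>g G\<bar> \<le> C"
begin

text \<open>The subtracted constant is the mean of the first term: \<open>U k\<close> is the
  leftmost factor of the partial circuit, and the unitary to its right is absorbed by right
  invariance.\<close>

definition deviation :: "nat \<Rightarrow> (nat \<Rightarrow> complex^'n^'n) \<Rightarrow> real" where
  "deviation k U = g (direction U H k \<theta>) - (\<integral>V. g (dagger V ** H ** V) \<partial>\<mu>)"

lemma borel_measurable_deviation [measurable]:
  "k \<le> p \<Longrightarrow> deviation k \<in> borel_measurable (iid_law \<mu> p)"
  unfolding deviation_def iid_law_def
  by (intro borel_measurable_diff borel_measurable_const borel_measurable_continuous_on[OF g]
      borel_measurable_direction) auto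

lemma continuous_on_conj: "continuous_on UNIV (\<lambda>V. g (dagger V ** H ** V))"
  by (intro continuous_on_compose2[OF g] matrix_mult.continuous_on continuous_intros) simp

lemma abs_deviation_le:
  assumes "U \<in> space (iid_law \<mu> p)" "k \<le> p"
  shows "\<bar>deviation k U\<bar> \<le> 2 * C"
proof -
  have "\<bar>\<integral>V. g (dagger V ** H ** V) \<partial>\<mu>\<bar> \<le> (\<integral>V. \<bar>g (dagger V ** H ** V)\<bar> \<partial>\<mu>)"
    by (rule integral_abs_bound)
  also have "\<dots> \<le> (\<integral>V. C \<partial>\<mu>)"
    by (intro integral_mono integrable_abs integrable_continuous[OF continuous_on_conj] integrable_const g_le)
      (simp add: space_haar unitary_SU norm_conj)
  finally have "\<bar>\<integral>V. g (dagger V ** H ** V) \<partial>\<mu>\<bar> \<le> C"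
    by (simp add: prob_space)
  moreover have "\<bar>g (direction U H k \<theta>)\<bar> \<le> C"
    using assms by (intro g_le norm_direction H unitary_SU space_iid_law[OF assms(1)]) auto
  ultimately show ?thesis
    unfolding deviation_def by linarith
qed

lemma integrable_deviation_mult:
  assumes "j \<le> p" "k \<le> p"
  shows "integrable (iid_law \<mu> p) (\<lambda>U. deviation j U * deviation k U)"
proof -
  interpret P: prob_space "iid_law \<mu> p" by (rule prob_space_iid_law)
  show ?thesis
  proof (rule P.integrable_const_bound[where B = "2 * C * (2 * C)"])
    show "AE U in iid_law \<mu> p. norm (deviation j U * deviation k U) \<le> 2 * C * (2 * C)"
      unfolding real_norm_def abs_mult
      by (intro AE_I2 mult_mono' abs_deviation_le assms) auto
  qed (use assms in measurable)
qed

text \<open>Integrating over \<open>U\<^sub>k\<close> alone averages the \<open>k\<close>-th deviation to \<open>0\<close> by right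
  invariance, while the earlier deviations do not depend on \<open>U\<^sub>k\<close>.\<close>

lemma integral_deviation_mult:
  assumes "j < k" "k \<le> p"
  shows "(\<integral>U. deviation j U * deviation k U \<partial>iid_law \<mu> p) = 0"
proof -
  interpret product_sigma_finite "\<lambda>_ :: nat. \<mu>" ..
  define I where "I = {0..p} - {k}"
  have I: "insert k I = {0..p}" "finite I" "k \<notin> I"
    using assms by (auto simp: I_def)
  have "(\<integral>U. deviation j U * deviation k U \<partial>iid_law \<mu> p)
      = (\<integral>U. (\<integral>V. deviation j (U(k := V)) * deviation k (U(k := V)) \<partial>\<mu>) \<partial>Pi\<^sub>M I (\<lambda>_. \<mu>))"
    using integrable_deviation_mult[of j k] assms
    unfolding iid_law_def I(1)[symmetric] by (intro product_integral_insert I) auto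
  also have "\<dots> = (\<integral>U. 0 \<partial>Pi\<^sub>M I (\<lambda>_. \<mu>))"
  proof (rule Bochner_Integration.integral_cong[OF refl])
    fix U assume "U \<in> space (Pi\<^sub>M I (\<lambda>_. \<mu>))"
    then have U: "unitary (U i)" if "i \<in> I" for i
      using that by (auto simp: space_PiM space_haar intro: unitary_SU)
    obtain k' where k': "k = Suc k'"
      using assms by (cases k) auto
    \<comment> \<open>Everything to the right of \<open>U k\<close> in the partial circuit; it does
      not change when \<open>U k\<close> is replaced by \<open>V\<close>.\<close>
    define T where "T = evolution H (\<theta> k) ** ansatz U H k' \<theta>"
    have "ansatz (U(k := V)) H j \<theta> = ansatz U H j \<theta>" "ansatz (U(k := V)) H k' \<theta> = ansatz U H k' \<theta>" for V
      using assms k' by (auto intro!: ansatz_cong)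
    then have V: "deviation j (U(k := V)) = deviation j U"
      "direction (U(k := V)) H k \<theta> = dagger (V ** T) ** H ** (V ** T)" for V
      unfolding deviation_def direction_def k' ansatz_Suc T_def by (simp_all add: matrix_mul_assoc)
    have "unitary T"
      unfolding T_def using assms k'
      by (intro unitary_mult unitary_evolution unitary_ansatz H U) (auto simp: I_def)
    then have "(\<integral>V. deviation k (U(k := V)) \<partial>\<mu>) = 0"
      using integral_conj_mult_right[OF g \<open>unitary T\<close>, of H]
        integrable_continuous[OF continuous_on_compose2[OF continuous_on_conj, of UNIV "\<lambda>V. V ** T"]]
      unfolding deviation_def V(2)
      by (simp add: prob_space matrix_mult.continuous_on continuous_on_id continuous_on_const)
    then show "(\<integral>V. deviation j (U(k := V)) * deviation k (U(k := V)) \<partial>\<mu>) = 0"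
      by (simp add: V(1))
  qed
  finally show ?thesis by simp
qed

text \<open>The mixed terms vanish, so the second moment grows only linearly in
  \<open>card S\<close>.\<close>

lemma integral_sum_deviation_le:
  assumes "S \<subseteq> {..p}"
  shows "(\<integral>U. (\<Sum>k\<in>S. deviation k U)\<^sup>2 \<partial>iid_law \<mu> p) \<le> card S * (2 * C)\<^sup>2"
proof -
  interpret P: prob_space "iid_law \<mu> p" by (rule prob_space_iid_law)
  have fin: "finite S"
    using assms finite_subset by blast
  have "(\<integral>U. (\<Sum>k\<in>S. deviation k U)\<^sup>2 \<partial>iid_law \<mu> p)
      = (\<Sum>j\<in>S. \<Sum>k\<in>S. \<integral>U. deviation j U * deviation k U \<partial>iid_law \<mu> p)"
    unfolding power2_eq_square sum_product using assms
    by (subst Bochner_Integration.integral_sum)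
      (auto intro!: Bochner_Integration.integrable_sum integrable_deviation_mult
        sum.cong Bochner_Integration.integral_sum)
  also have "\<dots> = (\<Sum>j\<in>S. \<Sum>k\<in>S. if k = j then \<integral>U. (deviation j U)\<^sup>2 \<partial>iid_law \<mu> p else 0)"
  proof (intro sum.cong refl)
    fix j k assume "j \<in> S" "k \<in> S"
    then show "(\<integral>U. deviation j U * deviation k U \<partial>iid_law \<mu> p)
        = (if k = j then \<integral>U. (deviation j U)\<^sup>2 \<partial>iid_law \<mu> p else 0)"
      using integral_deviation_mult[of j k] integral_deviation_mult[of k j] assms
      by (cases j k rule: linorder_cases) (auto simp: power2_eq_square mult.commute)
  qed
  also have "\<dots> = (\<Sum>j\<in>S. \<integral>U. (deviation j U)\<^sup>2 \<partial>iid_law \<mu> p)"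
    using fin by simp
  also have "\<dots> \<le> (\<Sum>j\<in>S. (2 * C)\<^sup>2)"
  proof (rule sum_mono)
    fix j assume "j \<in> S"
    then have j: "j \<le> p" using assms by auto
    have "(\<integral>U. (deviation j U)\<^sup>2 \<partial>iid_law \<mu> p) \<le> (\<integral>U. (2 * C)\<^sup>2 \<partial>iid_law \<mu> p)"
      using integrable_deviation_mult[OF j j] power_mono[OF abs_deviation_le[OF _ j] abs_ge_zero, of _ 2]
      by (intro integral_mono) (auto simp: power2_eq_square)
    then show "(\<integral>U. (deviation j U)\<^sup>2 \<partial>iid_law \<mu> p) \<le> (2 * C)\<^sup>2"
      by (simp add: P.prob_space)
  qed
  finally show ?thesis by simp
qed

text \<open>Chebyshev's inequality, as Markov's inequality for the square.\<close>

lemma prob_sum_deviation_ge: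
  assumes "S \<subseteq> {..p}" "c > 0"
  shows "measure (iid_law \<mu> p) {U \<in> space (iid_law \<mu> p). c \<le> \<bar>\<Sum>k\<in>S. deviation k U\<bar>}
    \<le> card S * (2 * C)\<^sup>2 / c\<^sup>2"
proof -
  have "integrable (iid_law \<mu> p) (\<lambda>U. (\<Sum>k\<in>S. deviation k U)\<^sup>2)"
    unfolding power2_eq_square sum_product using assms
    by (auto intro!: Bochner_Integration.integrable_sum integrable_deviation_mult)
  then have "measure (iid_law \<mu> p) {U \<in> space (iid_law \<mu> p). c\<^sup>2 \<le> (\<Sum>k\<in>S. deviation k U)\<^sup>2}
      \<le> (\<integral>U. (\<Sum>k\<in>S. deviation k U)\<^sup>2 \<partial>iid_law \<mu> p) / c\<^sup>2"
    using assms by (intro integral_Markov_inequality_measure[OF _ sets.top]) auto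
  also have "\<dots> \<le> card S * (2 * C)\<^sup>2 / c\<^sup>2"
    using integral_sum_deviation_le[OF assms(1)] by (intro divide_right_mono) auto
  also have "{U \<in> space (iid_law \<mu> p). c\<^sup>2 \<le> (\<Sum>k\<in>S. deviation k U)\<^sup>2}
      = {U \<in> space (iid_law \<mu> p). c \<le> \<bar>\<Sum>k\<in>S. deviation k U\<bar>}"
    using assms(2) by (auto simp: abs_le_square_iff[symmetric])
  finally show ?thesis .
qed

end

section \<open>Block averages and the lower bound uniform near the starting point\<close>

abbreviation (input) direction_moment :: "complex^'n^'n \<Rightarrow> complex^'n^'n \<Rightarrow> complex^'n^'n \<Rightarrow> real" where
  "direction_moment H u v \<equiv> \<integral>V. ((dagger V ** H ** V) \<bullet> u) * ((dagger V ** H ** V) \<bullet> v) \<partial>\<mu>"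

text \<open>Union bound over finitely many averages, one for each block and each pair of basis
  matrices. Neither the number of events nor \<open>N\<close> depends on \<open>p\<close> or
  \<theta>; the last \<open>p mod B\<close> indices before \<open>p\<close> belong to no
  block.\<close>

lemma block_averages:
  fixes H :: "complex^'n^'n" and \<epsilon> \<delta> :: real and B :: nat
  assumes H: "hermitian H" and pos: "\<epsilon> > 0" "\<delta> > 0" and B: "B > 0"
  obtains N where "\<And>p \<theta>. N \<le> p div B \<Longrightarrow>
    \<exists>A\<in>sets (iid_law \<mu> p). 1 - \<delta> \<le> measure (iid_law \<mu> p) A \<and>
      (\<forall>U\<in>A. (\<forall>k\<le>p. U k \<in> SU) \<and> (\<forall>b<B. \<forall>u\<in>Basis. \<forall>v\<in>Basis.
        \<bar>\<Sum>k = b * (p div B)..<Suc b * (p div B).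
          (direction U H k \<theta> \<bullet> u) * (direction U H k \<theta> \<bullet> v) - direction_moment H u v\<bar>
        \<le> (p div B) * \<epsilon>))"
proof -
  \<comment> \<open>Chebyshev for a block of length \<open>n\<close> at threshold
    \<open>n * \<epsilon>\<close>, with deviations bounded by \<open>2 * (norm H)\<^sup>2\<close>,
    gives failure probability at most \<open>c / n\<close>.\<close>
  define c where "c = (2 * (norm H)\<^sup>2)\<^sup>2 / \<epsilon>\<^sup>2"
  define I where "I = {..<B} \<times> (Basis :: (complex^'n^'n) set) \<times> (Basis :: (complex^'n^'n) set)"
  have finI: "finite I" by (simp add: I_def)
  obtain N :: nat where N: "card I * c / \<delta> < N"
    using reals_Archimedean2 by blast
  show ?thesis
  proof (rule that[of "max 1 N"])
    fix p \<theta> assume "max 1 N \<le> p div B"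
    define n where "n = p div B"
    with \<open>max 1 N \<le> p div B\<close> have n: "n \<ge> 1" "N \<le> n" by auto
    interpret P: prob_space "iid_law \<mu> p" by (rule prob_space_iid_law)
    define Z where "Z u v = deviation H (\<lambda>G. (G \<bullet> u) * (G \<bullet> v)) \<theta>" for u v
    define S where "S b = {b * n..<Suc b * n}" for b
    define F where "F i = (case i of (b, u, v) \<Rightarrow>
      {U \<in> space (iid_law \<mu> p). n * \<epsilon> \<le> \<bar>\<Sum>k\<in>S b. Z u v k U\<bar>})" for i
    have S: "S b \<subseteq> {..p}" if "b < B" for b
    proof -
      have "Suc b * n \<le> B * n" using that by (intro mult_right_mono) auto
      also have "\<dots> \<le> p" by (simp add: n_def)
      finally show ?thesis by (auto simp: S_def)
    qed
    have g: "continuous_on UNIV (\<lambda>G. (G \<bullet> u) * (G \<bullet> v))" for u v :: "complex^'n^'n"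
      by (intro continuous_intros)
    have g_le: "\<bar>(G \<bullet> u) * (G \<bullet> v)\<bar> \<le> (norm H)\<^sup>2" if "norm G = norm H" "u \<in> Basis" "v \<in> Basis"
      for G u v :: "complex^'n^'n"
      unfolding abs_mult power2_eq_square that(1)[symmetric]
      using that by (intro mult_mono Basis_le_norm) auto
    have sets: "F i \<in> sets (iid_law \<mu> p)" if "i \<in> I" for i
    proof -
      obtain b u v where i: "i = (b, u, v)" "b < B" "u \<in> Basis" "v \<in> Basis"
        using \<open>i \<in> I\<close> by (auto simp: I_def)
      have [measurable]: "Z u v k \<in> borel_measurable (iid_law \<mu> p)" if "k \<in> S b" for k
        unfolding Z_def using that S[OF i(2)] by (intro borel_measurable_deviation[OF H g g_le[OF _ i(3,4)]]) auto
      show ?thesis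
        unfolding F_def i(1) prod.case by measurable
    qed
    have F: "measure (iid_law \<mu> p) (F i) \<le> c / n" if "i \<in> I" for i
    proof -
      obtain b u v where i: "i = (b, u, v)" "b < B" "u \<in> Basis" "v \<in> Basis"
        using \<open>i \<in> I\<close> by (auto simp: I_def)
      have "measure (iid_law \<mu> p) (F i) \<le> card (S b) * (2 * (norm H)\<^sup>2)\<^sup>2 / (n * \<epsilon>)\<^sup>2"
        unfolding F_def i(1) prod.case Z_def
        using n pos by (intro prob_sum_deviation_ge[OF H g] S i g_le) auto
      also have "\<dots> = c / n"
        using n by (simp add: S_def c_def field_simps power2_eq_square)
      finally show ?thesis .
    qed
    define A where "A = space (iid_law \<mu> p) - (\<Union>i\<in>I. F i)"
    have "measure (iid_law \<mu> p) (\<Union>i\<in>I. F i) \<le> (\<Sum>i\<in>I. measure (iid_law \<mu> p) (F i))"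
      by (rule P.finite_measure_subadditive_finite[OF finI]) (use sets in auto)
    also have "\<dots> \<le> card I * (c / n)"
      by (rule sum_bounded_above[OF F])
    also have "\<dots> \<le> \<delta>"
    proof -
      have "card I * c / \<delta> \<le> n"
        using N n by linarith
      then show ?thesis
        using n pos by (simp add: field_simps)
    qed
    finally have "1 - \<delta> \<le> measure (iid_law \<mu> p) A"
      unfolding A_def using sets finI by (subst P.prob_compl) auto
    moreover have "A \<in> sets (iid_law \<mu> p)"
      unfolding A_def using sets finI by (intro sets.Diff sets.top sets.finite_UN) auto
    moreover have "\<forall>k\<le>p. U k \<in> SU" if "U \<in> A" for U
      using that space_iid_law by (auto simp: A_def)
    moreover have "\<bar>\<Sum>k\<in>S b. (direction U H k \<theta> \<bullet> u) * (direction U H k \<theta> \<bullet> v) - direction_moment H u v\<bar>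
        \<le> n * \<epsilon>" if "U \<in> A" "b < B" "u \<in> Basis" "v \<in> Basis" for U b u v
    proof -
      have "(b, u, v) \<in> I" using that by (auto simp: I_def)
      then have "U \<notin> F (b, u, v)" "U \<in> space (iid_law \<mu> p)"
        using that by (auto simp: A_def)
      then show ?thesis
        by (auto simp: F_def Z_def deviation_def[OF H g g_le[OF _ that(3,4)]])
    qed
    ultimately show "\<exists>A\<in>sets (iid_law \<mu> p). 1 - \<delta> \<le> measure (iid_law \<mu> p) A \<and>
      (\<forall>U\<in>A. (\<forall>k\<le>p. U k \<in> SU) \<and> (\<forall>b<B. \<forall>u\<in>Basis. \<forall>v\<in>Basis.
        \<bar>\<Sum>k = b * (p div B)..<Suc b * (p div B).
          (direction U H k \<theta> \<bullet> u) * (direction U H k \<theta> \<bullet> v) - direction_moment H u v\<bar>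
        \<le> (p div B) * \<epsilon>))"
      unfolding S_def n_def by blast
  qed
qed

text \<open>Expand the quadratic form in the basis. Each coordinate of \<open>X\<close> is at most
  \<open>norm X\<close>, so the errors of all pairs of basis matrices cost at most \<epsilon> times
  the squared dimension. Since \<open>X\<close> is arbitrary here, one event serves all test
  matrices, including those that depend on the path.\<close>

lemma sum_block_ge:
  fixes H X :: "complex^'n^'n" and \<epsilon> :: real
  assumes H: "hermitian H" "trace H = 0" and X: "hermitian X" "trace X = 0"
    and card: "CARD('n) \<ge> 2" and \<epsilon>: "\<epsilon> \<ge> 0"
    and avg: "\<And>u v. u \<in> Basis \<Longrightarrow> v \<in> Basis \<Longrightarrow>
      \<bar>\<Sum>k\<in>S. (G k \<bullet> u) * (G k \<bullet> v) - direction_moment H u v\<bar> \<le> card S * \<epsilon>"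
  shows "card S * (norm X)\<^sup>2 * ((norm H)\<^sup>2 / ((real CARD('n))\<^sup>2 - 1) - (real DIM(complex^'n^'n))\<^sup>2 * \<epsilon>)
    \<le> (\<Sum>k\<in>S. (G k \<bullet> X)\<^sup>2)"
proof -
  define D where "D = real DIM(complex^'n^'n)"
  have sq: "(Y \<bullet> X)\<^sup>2 = (\<Sum>u\<in>Basis. \<Sum>v\<in>Basis. (X \<bullet> u) * (X \<bullet> v) * ((Y \<bullet> u) * (Y \<bullet> v)))" for Y
  proof -
    have "Y \<bullet> X = (\<Sum>u\<in>Basis. (Y \<bullet> u) * (X \<bullet> u))"
      by (rule euclidean_inner)
    then show ?thesis
      by (simp add: power2_eq_square sum_product mult_ac)
  qed
  have int: "integrable \<mu> (\<lambda>V. ((dagger V ** H ** V) \<bullet> u) * ((dagger V ** H ** V) \<bullet> v))" for u v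
    by (intro integrable_continuous continuous_intros matrix_mult.continuous_on)
  have "(\<integral>V. ((dagger V ** H ** V) \<bullet> X)\<^sup>2 \<partial>\<mu>)
      = (\<Sum>u\<in>Basis. \<Sum>v\<in>Basis. (X \<bullet> u) * (X \<bullet> v) * direction_moment H u v)"
    unfolding sq
    by (simp add: Bochner_Integration.integral_sum int)
  then have mean: "(\<Sum>u\<in>Basis. \<Sum>v\<in>Basis. (X \<bullet> u) * (X \<bullet> v) * direction_moment H u v)
      = (norm H)\<^sup>2 * (norm X)\<^sup>2 / ((real CARD('n))\<^sup>2 - 1)"
    using second_moment[OF H X card] by simp
  define err where "err u v = (\<Sum>k\<in>S. (G k \<bullet> u) * (G k \<bullet> v) - direction_moment H u v)" for u v
  have "(\<Sum>k\<in>S. (G k \<bullet> X)\<^sup>2) - card S * ((norm H)\<^sup>2 * (norm X)\<^sup>2 / ((real CARD('n))\<^sup>2 - 1))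
      = (\<Sum>k\<in>S. \<Sum>u\<in>Basis. \<Sum>v\<in>Basis.
          (X \<bullet> u) * (X \<bullet> v) * ((G k \<bullet> u) * (G k \<bullet> v) - direction_moment H u v))"
    unfolding mean[symmetric] sq by (simp add: right_diff_distrib sum_subtractf)
  also have "\<dots> = (\<Sum>u\<in>Basis. \<Sum>k\<in>S. \<Sum>v\<in>Basis.
          (X \<bullet> u) * (X \<bullet> v) * ((G k \<bullet> u) * (G k \<bullet> v) - direction_moment H u v))"
    by (rule sum.swap)
  also have "\<dots> = (\<Sum>u\<in>Basis. \<Sum>v\<in>Basis. (X \<bullet> u) * (X \<bullet> v) * err u v)"
    unfolding err_def sum_distrib_left by (intro sum.cong refl sum.swap)
  also have "\<dots> \<ge> (\<Sum>u\<in>(Basis :: (complex^'n^'n) set). \<Sum>v\<in>(Basis :: (complex^'n^'n) set).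
      - (norm X * norm X * (card S * \<epsilon>)))"
  proof (intro sum_mono)
    fix u v :: "complex^'n^'n" assume "u \<in> Basis" "v \<in> Basis"
    then have "\<bar>(X \<bullet> u) * (X \<bullet> v) * err u v\<bar> \<le> norm X * norm X * (card S * \<epsilon>)"
      unfolding abs_mult err_def by (intro mult_mono Basis_le_norm avg) auto
    then show "- (norm X * norm X * (card S * \<epsilon>)) \<le> (X \<bullet> u) * (X \<bullet> v) * err u v"
      by linarith
  qed
  finally have "card S * ((norm H)\<^sup>2 * (norm X)\<^sup>2 / ((real CARD('n))\<^sup>2 - 1))
      - D * (D * (norm X * norm X * (card S * \<epsilon>))) \<le> (\<Sum>k\<in>S. (G k \<bullet> X)\<^sup>2)"
    by (simp add: D_def del: DIM_cart)
  then show ?thesis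
    by (simp add: D_def[symmetric] algebra_simps power2_eq_square del: DIM_cart)
qed

theorem uniform_lower_bound:
  fixes H :: "complex^'n^'n" and R \<delta> :: real
  assumes H: "hermitian H" "trace H = 0" "H \<noteq> 0" and card: "CARD('n) \<ge> 2"
    and R: "R > 0" and \<delta>: "\<delta> > 0"
  shows "\<exists>p\<^sub>0\<ge>1. \<forall>p\<ge>p\<^sub>0. \<forall>\<theta>\<^sub>0. \<exists>A\<in>sets (iid_law \<mu> p). 1 - \<delta> \<le> measure (iid_law \<mu> p) A \<and>
    (\<forall>U\<in>A. (\<forall>k\<le>p. U k \<in> SU) \<and>
      (\<forall>\<theta> X. (\<forall>l\<in>{1..p}. \<bar>\<theta> l - \<theta>\<^sub>0 l\<bar> \<le> R / p) \<longrightarrow> hermitian X \<longrightarrow> trace X = 0 \<longrightarrow>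
        p * ((norm H)\<^sup>2 / ((real CARD('n))\<^sup>2 - 1)) * (norm X)\<^sup>2 / 4 \<le> (\<Sum>k<p. (direction U H k \<theta> \<bullet> X)\<^sup>2)))"
proof -
  obtain K where K: "K > 0" "\<And>(A :: complex^'n^'n) (B :: complex^'n^'n). norm (A ** B) \<le> norm A * norm B * K"
    using norm_matrix_mult_le by blast
  define \<kappa> where "\<kappa> = (norm H)\<^sup>2 / ((real CARD('n))\<^sup>2 - 1)"
  define D where "D = real DIM(complex^'n^'n)"
  have "(real CARD('n))\<^sup>2 - 1 > 0"
    using card by (simp add: one_less_power)
  then have \<kappa>: "\<kappa> > 0"
    using H by (simp add: \<kappa>_def)
  have D: "D > 0"
    unfolding D_def by (metis DIM_positive of_nat_0_less_iff)
  \<comment> \<open>Fluctuations may cost a quarter of the mean \<kappa>.\<close>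
  define \<epsilon> where "\<epsilon> = \<kappa> / (4 * D\<^sup>2)"
  have \<epsilon>: "\<epsilon> > 0" "D\<^sup>2 * \<epsilon> = \<kappa> / 4"
    using \<kappa> D by (auto simp: \<epsilon>_def)
  \<comment> \<open>\<open>L / B\<close> bounds, relative to \<open>(norm X)\<^sup>2\<close>, the
    cross term created by freezing the conjugation on a block; \<open>B\<close> is chosen so that
    this costs another quarter of \<kappa>.\<close>
  define L where "L = 4 * K * norm H ^ 3 * R"
  have L: "L \<ge> 0"
    using K R by (simp add: L_def)
  obtain B :: nat where B: "4 * L / \<kappa> < B"
    using reals_Archimedean2 by blast
  have "4 * L / \<kappa> \<ge> 0"
    using L \<kappa> by simp
  with B have "B > 0"
    by linarith
  have BL: "L / B \<le> \<kappa> / 4"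
    using B \<kappa> \<open>B > 0\<close> by (simp add: field_simps)
  obtain N where N: "\<And>p \<theta>. N \<le> p div B \<Longrightarrow>
    \<exists>A\<in>sets (iid_law \<mu> p). 1 - \<delta> \<le> measure (iid_law \<mu> p) A \<and>
      (\<forall>U\<in>A. (\<forall>k\<le>p. U k \<in> SU) \<and> (\<forall>b<B. \<forall>u\<in>Basis. \<forall>v\<in>Basis.
        \<bar>\<Sum>k = b * (p div B)..<Suc b * (p div B).
          (direction U H k \<theta> \<bullet> u) * (direction U H k \<theta> \<bullet> v) - direction_moment H u v\<bar>
        \<le> (p div B) * \<epsilon>))"
    using block_averages[OF H(1) \<epsilon>(1) \<delta> \<open>B > 0\<close>] by blast
  show ?thesis
  proof (intro exI[of _ "max 1 N * B"] conjI allI impI)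
    show "1 \<le> max 1 N * B"
      using \<open>B > 0\<close> by (simp add: Suc_le_eq)
    fix p \<theta>\<^sub>0 assume p: "max 1 N * B \<le> p"
    define n where "n = p div B"
    have n: "1 \<le> n" "N \<le> n"
      using div_le_mono[OF p, of B] \<open>B > 0\<close> by (simp_all add: n_def)
    have "p = B * n + p mod B" "p mod B < B" "B \<le> B * n"
      using n \<open>B > 0\<close> by (simp_all add: n_def)
    \<comment> \<open>The remainder is smaller than \<open>B\<close>, hence than the covered part:
      the blocks contain at least half of the indices.\<close>
    then have Bn: "B * n \<le> p" "p \<le> 2 * (B * n)"
      by linarith+
    have "p > 0"
      using Bn n \<open>B > 0\<close> by (cases p) auto
    obtain A where A: "A \<in> sets (iid_law \<mu> p)" "1 - \<delta> \<le> measure (iid_law \<mu> p) A"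
      "\<And>U k. U \<in> A \<Longrightarrow> k \<le> p \<Longrightarrow> U k \<in> SU"
      and avg: "\<And>U b u v. U \<in> A \<Longrightarrow> b < B \<Longrightarrow> u \<in> Basis \<Longrightarrow> v \<in> Basis \<Longrightarrow>
        \<bar>\<Sum>k = b * n..<Suc b * n.
          (direction U H k \<theta>\<^sub>0 \<bullet> u) * (direction U H k \<theta>\<^sub>0 \<bullet> v) - direction_moment H u v\<bar> \<le> n * \<epsilon>"
      using N[of p \<theta>\<^sub>0] n unfolding n_def by blast
    show "\<exists>A\<in>sets (iid_law \<mu> p). 1 - \<delta> \<le> measure (iid_law \<mu> p) A \<and>
      (\<forall>U\<in>A. (\<forall>k\<le>p. U k \<in> SU) \<and>
      (\<forall>\<theta> X. (\<forall>l\<in>{1..p}. \<bar>\<theta> l - \<theta>\<^sub>0 l\<bar> \<le> R / p) \<longrightarrow> hermitian X \<longrightarrow> trace X = 0 \<longrightarrow>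
        p * ((norm H)\<^sup>2 / ((real CARD('n))\<^sup>2 - 1)) * (norm X)\<^sup>2 / 4 \<le> (\<Sum>k<p. (direction U H k \<theta> \<bullet> X)\<^sup>2)))"
      unfolding \<kappa>_def[symmetric]
    proof (intro bexI[OF _ A(1)] conjI A(2,3) ballI allI impI; assumption?)
      fix U \<theta> and X :: "complex^'n^'n"
      assume U: "U \<in> A" and \<theta>: "\<forall>l\<in>{1..p}. \<bar>\<theta> l - \<theta>\<^sub>0 l\<bar> \<le> R / p" and X: "hermitian X" "trace X = 0"
      have unitary_U: "unitary (U k)" if "k \<le> p" for k
        using A(3)[OF U that] by (rule unitary_SU)
      define V W where "V k = ansatz U H k \<theta>" and "W k = ansatz U H k \<theta>\<^sub>0" for k
      \<comment> \<open>The change of the partial circuit relative to the starting point: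
        \<open>V k = W k ** Q k\<close>.\<close>
      define Q where "Q k = dagger (W k) ** V k" for k
      define Y where "Y k = Q k ** X ** dagger (Q k)" for k
      define G where "G k = direction U H k \<theta>\<^sub>0" for k
      have uVW: "unitary (V k)" "unitary (W k)" if "k \<le> p" for k
        unfolding V_def W_def using that by (auto intro!: unitary_ansatz H unitary_U)
      have uQ: "unitary (Q k)" if "k \<le> p" for k
        unfolding Q_def using uVW[OF that] by (simp add: unitary_mult)
      have G: "norm (G k) = norm H" if "k \<le> p" for k
        unfolding G_def using that by (intro norm_direction H unitary_U) auto
      have inner: "direction U H k \<theta> \<bullet> X = G k \<bullet> Y k" if "k \<le> p" for k
      proof -
        have "V k = W k ** Q k"
          unfolding Q_def by (simp add: unitary_cancel uVW that)
        then have "direction U H k \<theta> = dagger (Q k) ** G k ** Q k"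
          unfolding direction_def G_def V_def[symmetric] W_def[symmetric]
          by (simp add: dagger_mult matrix_mul_assoc)
        then show ?thesis
          by (simp add: inner_conj Y_def)
      qed
      \<comment> \<open>The common gate \<open>U (Suc k)\<close> cancels between
        \<open>dagger (W (Suc k))\<close> and \<open>V (Suc k)\<close>, so only the difference of
        the two evolutions is left, between unitaries.\<close>
      have Q_step: "norm (Q (Suc k) - Q k) \<le> norm H * R / p" if "Suc k \<le> p" for k
      proof -
        let ?E = "evolution H (\<theta> (Suc k))" and ?F = "evolution H (\<theta>\<^sub>0 (Suc k))"
        have E: "unitary ?E" "unitary ?F"
          by (rule unitary_evolution[OF H(1)])+
        have "Q (Suc k) = dagger (W k) ** (dagger ?F ** ((dagger (U (Suc k)) ** (U (Suc k) ** (?E ** V k)))))"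
          unfolding Q_def V_def W_def ansatz_Suc dagger_mult by (simp add: matrix_mul_assoc)
        then have 1: "Q (Suc k) = dagger (W k) ** (dagger ?F ** (?E ** V k))"
          by (simp add: unitary_cancel unitary_U that)
        have 2: "Q k = dagger (W k) ** (dagger ?F ** (?F ** V k))"
          by (simp add: Q_def unitary_cancel E)
        have "Q (Suc k) - Q k = dagger (W k) ** (dagger ?F ** ((?E - ?F) ** V k))"
          unfolding 1 2 by (simp only: matrix_mult.diff_left matrix_mult.diff_right)
        then have "norm (Q (Suc k) - Q k) = norm (?E - ?F)"
          using that E by (simp add: norm_unitary_left norm_unitary_right uVW)
        also have "\<dots> \<le> norm H * \<bar>\<theta> (Suc k) - \<theta>\<^sub>0 (Suc k)\<bar>"
          by (rule norm_evolution_diff_le[OF H(1)])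
        also have "\<dots> \<le> norm H * (R / p)"
          using \<theta> that by (intro mult_left_mono) auto
        finally show ?thesis by simp
      qed
      have Q_diff: "norm (Q (j + i) - Q j) \<le> i * (norm H * R / p)" if "j + i \<le> p" for i j
        using that
      proof (induction i)
        case (Suc i)
        have "norm (Q (j + Suc i) - Q j) \<le> norm (Q (Suc (j + i)) - Q (j + i)) + norm (Q (j + i) - Q j)"
          using norm_triangle_ineq[of "Q (Suc (j + i)) - Q (j + i)" "Q (j + i) - Q j"] by simp
        also have "\<dots> \<le> norm H * R / p + i * (norm H * R / p)"
          using Suc by (intro add_mono Q_step) auto
        finally show ?case by (simp add: algebra_simps add_divide_distrib)
      qed simp
      \<comment> \<open>Of the mean \<kappa>, a quarter is lost to fluctuations and a quarter to
        freezing, which leaves one half.\<close>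
      have block: "n * \<kappa> * (norm X)\<^sup>2 / 2 \<le> (\<Sum>k = b * n..<Suc b * n. (direction U H k \<theta> \<bullet> X)\<^sup>2)"
        if b: "b < B" for b
      proof -
        let ?S = "{b * n..<Suc b * n}"
        have "Suc b * n \<le> B * n" using that by (intro mult_right_mono) auto
        with Bn have Sp: "Suc b * n \<le> p" by linarith
        then have bp: "b * n \<le> p" by simp
        have Yb: "hermitian (Y (b * n))" "trace (Y (b * n)) = 0" "norm (Y (b * n)) = norm X"
          unfolding Y_def using uQ[OF bp] X by (simp_all add: hermitian_conj trace_conj norm_conj)
        have "card ?S * (norm (Y (b * n)))\<^sup>2 * (\<kappa> - D\<^sup>2 * \<epsilon>) \<le> (\<Sum>k\<in>?S. (G k \<bullet> Y (b * n))\<^sup>2)"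
          unfolding \<kappa>_def D_def
          by (rule sum_block_ge[OF H(1,2) Yb(1,2) card])
            (use avg[OF U b] \<epsilon>(1) in \<open>simp_all add: G_def less_imp_le\<close>)
        then have 1: "n * (norm X)\<^sup>2 * (3 * \<kappa> / 4) \<le> (\<Sum>k\<in>?S. (G k \<bullet> Y (b * n))\<^sup>2)"
          by (simp add: Yb \<epsilon>)
        have 2: "(G k \<bullet> Y (b * n))\<^sup>2 - (norm X)\<^sup>2 * (\<kappa> / 4) \<le> (direction U H k \<theta> \<bullet> X)\<^sup>2" if k: "k \<in> ?S" for k
        proof -
          have kp: "k \<le> p" using k Sp by auto
          have "norm (Q k - Q (b * n)) \<le> (k - b * n) * (norm H * R / p)"
            using Q_diff[of "b * n" "k - b * n"] k kp by simp
          \<comment> \<open>The block length is at most \<open>p / B\<close>, so the factors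
            \<open>p\<close> cancel and the drift within a block is uniform in
            \<open>p\<close>.\<close>
          also have "\<dots> \<le> (p / B) * (norm H * R / p)"
          proof (rule mult_right_mono)
            have "real (k - b * n) \<le> real n"
              using k by (intro of_nat_mono) auto
            also have "\<dots> \<le> p / B"
              using Bn \<open>B > 0\<close> by (simp add: field_simps flip: of_nat_mult)
            finally show "real (k - b * n) \<le> p / B" .
          qed (use R in simp)
          also have "\<dots> = norm H * R / B"
            using \<open>p > 0\<close> by simp
          finally have Qk: "norm (Q k - Q (b * n)) \<le> norm H * R / B" .
          have "norm (Y k - Y (b * n)) \<le> 2 * K * norm (Q k - Q (b * n)) * norm X"
            unfolding Y_def by (rule norm_diff_conj_le[OF uQ[OF kp] uQ[OF bp] K(2)])
          also have "\<dots> \<le> 2 * K * (norm H * R / B) * norm X"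
            using Qk K(1) by (intro mult_right_mono mult_left_mono) auto
          finally have Yk: "norm (Y k - Y (b * n)) \<le> 2 * K * (norm H * R / B) * norm X" .
          have "\<bar>G k \<bullet> Y (b * n)\<bar> \<le> norm H * norm X"
            using Cauchy_Schwarz_ineq2[of "G k" "Y (b * n)"] by (simp add: G[OF kp] Yb)
          moreover have "\<bar>G k \<bullet> (Y k - Y (b * n))\<bar> \<le> norm H * (2 * K * (norm H * R / B) * norm X)"
            using Cauchy_Schwarz_ineq2[of "G k" "Y k - Y (b * n)"] mult_left_mono[OF Yk, of "norm H"]
            by (simp add: G[OF kp])
          ultimately have "\<bar>G k \<bullet> Y (b * n)\<bar> * \<bar>G k \<bullet> (Y k - Y (b * n))\<bar>
              \<le> norm H * norm X * (norm H * (2 * K * (norm H * R / B) * norm X))"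
            by (intro mult_mono) auto
          also have "\<dots> = (norm X)\<^sup>2 * (L / B) / 2"
            by (simp add: L_def power2_eq_square power3_eq_cube)
          also have "\<dots> \<le> (norm X)\<^sup>2 * (\<kappa> / 4) / 2"
            using BL by (intro divide_right_mono mult_left_mono) auto
          finally have "- (2 * (G k \<bullet> Y (b * n)) * (G k \<bullet> (Y k - Y (b * n)))) \<le> (norm X)\<^sup>2 * (\<kappa> / 4)"
            unfolding abs_mult[symmetric] by linarith
          \<comment> \<open>Only the cross term can be negative; the last square is dropped.\<close>
          moreover have "(G k \<bullet> Y k)\<^sup>2 = (G k \<bullet> Y (b * n))\<^sup>2
              + 2 * (G k \<bullet> Y (b * n)) * (G k \<bullet> (Y k - Y (b * n))) + (G k \<bullet> (Y k - Y (b * n)))\<^sup>2"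
            by (simp add: inner_diff_right power2_eq_square algebra_simps)
          ultimately show ?thesis
            unfolding inner[OF kp] using zero_le_power2[of "G k \<bullet> (Y k - Y (b * n))"] by linarith
        qed
        have "n * \<kappa> * (norm X)\<^sup>2 / 2 = n * (norm X)\<^sup>2 * (3 * \<kappa> / 4) - n * ((norm X)\<^sup>2 * (\<kappa> / 4))"
          by (simp add: field_simps)
        also have "\<dots> \<le> (\<Sum>k\<in>?S. (G k \<bullet> Y (b * n))\<^sup>2) - n * ((norm X)\<^sup>2 * (\<kappa> / 4))"
          using 1 by linarith
        also have "\<dots> = (\<Sum>k\<in>?S. (G k \<bullet> Y (b * n))\<^sup>2 - (norm X)\<^sup>2 * (\<kappa> / 4))"
          by (simp add: sum_subtractf)
        also have "\<dots> \<le> (\<Sum>k\<in>?S. (direction U H k \<theta> \<bullet> X)\<^sup>2)"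
          by (rule sum_mono) (rule 2)
        finally show ?thesis .
      qed
      have blocks: "c * (n * \<kappa> * (norm X)\<^sup>2 / 2) \<le> (\<Sum>k<c * n. (direction U H k \<theta> \<bullet> X)\<^sup>2)" if "c \<le> B" for c
        using that
      proof (induction c)
        case (Suc c)
        have "(\<Sum>k<Suc c * n. (direction U H k \<theta> \<bullet> X)\<^sup>2)
            = (\<Sum>k<c * n. (direction U H k \<theta> \<bullet> X)\<^sup>2) + (\<Sum>k = c * n..<Suc c * n. (direction U H k \<theta> \<bullet> X)\<^sup>2)"
          unfolding lessThan_atLeast0 by (rule sum.atLeastLessThan_concat[symmetric]) simp_all
        moreover have "real c * (n * \<kappa> * (norm X)\<^sup>2 / 2) \<le> (\<Sum>k<c * n. (direction U H k \<theta> \<bullet> X)\<^sup>2)"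
          using Suc by simp
        moreover have "real (Suc c) * (n * \<kappa> * (norm X)\<^sup>2 / 2)
            = real c * (n * \<kappa> * (norm X)\<^sup>2 / 2) + n * \<kappa> * (norm X)\<^sup>2 / 2"
          by (simp add: algebra_simps)
        ultimately show ?case
          using block[of c] Suc.prems by simp
      qed simp
      \<comment> \<open>The incomplete last block costs a further factor of two, which explains the
        constant 4.\<close>
      have "p * \<kappa> * (norm X)\<^sup>2 / 4 \<le> real (2 * (B * n)) * \<kappa> * (norm X)\<^sup>2 / 4"
        using Bn \<kappa> by (intro divide_right_mono mult_right_mono) (auto simp del: of_nat_mult)
      also have "\<dots> = B * (n * \<kappa> * (norm X)\<^sup>2 / 2)"
        by simp
      also have "\<dots> \<le> (\<Sum>k<B * n. (direction U H k \<theta> \<bullet> X)\<^sup>2)"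
        by (rule blocks) simp
      also have "\<dots> \<le> (\<Sum>k<p. (direction U H k \<theta> \<bullet> X)\<^sup>2)"
        using Bn by (intro sum_mono2) auto
      finally show "p * \<kappa> * (norm X)\<^sup>2 / 4 \<le> (\<Sum>k<p. (direction U H k \<theta> \<bullet> X)\<^sup>2)" .
    qed
  qed
qed

end

subsection \<open>The smallest eigenvalue of a symmetric matrix\<close>

text \<open>Eigenvectors chosen for distinct eigenvalues are orthogonal, hence independent.
  Finiteness is what gives \<open>Min\<close> its meaning in
  \<open>smallest_eigenvalue\<close>.\<close>

lemma finite_eigenvalues:
  fixes A :: "real^'m^'m"
  assumes A: "transpose A = A"
  shows "finite {c. \<exists>v. v \<noteq> 0 \<and> A *v v = c *\<^sub>R v}" (is "finite ?E")
proof -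
  define f where "f c = (SOME v. v \<noteq> 0 \<and> A *v v = c *\<^sub>R v)" for c
  have f: "f c \<noteq> 0 \<and> A *v f c = c *\<^sub>R f c" if "c \<in> ?E" for c
    unfolding f_def by (rule someI_ex) (use that in simp)
  have orth: "f c \<bullet> f c' = 0" if "c \<in> ?E" "c' \<in> ?E" "c \<noteq> c'" for c c'
  proof -
    have "c * (f c \<bullet> f c') = (A *v f c) \<bullet> f c'"
      using f[OF that(1)] by simp
    also have "\<dots> = f c \<bullet> (A *v f c')"
      using A by (metis dot_lmul_matrix transpose_matrix_vector)
    also have "\<dots> = c' * (f c \<bullet> f c')"
      using f[OF that(2)] by simp
    finally show ?thesis
      using that(3) by simp
  qed
  have "inj_on f ?E"
  proof (rule inj_onI, rule ccontr)
    fix c c' assume c: "c \<in> ?E" "c' \<in> ?E" "f c = f c'" "c \<noteq> c'"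
    then have "f c = 0"
      using orth[OF c(1,2,4)] by simp
    with f[OF c(1)] show False by simp
  qed
  moreover have "finite (f ` ?E)"
  proof (rule independent_imp_finite, rule pairwise_orthogonal_independent)
    show "pairwise orthogonal (f ` ?E)"
      unfolding pairwise_def orthogonal_def using orth by blast
    show "0 \<notin> f ` ?E"
      using f by force
  qed
  ultimately show ?thesis
    using finite_imageD by blast
qed

text \<open>The minimum of the quadratic form on the unit sphere is an eigenvalue.\<close>

lemma smallest_eigenvalue_le:
  fixes A :: "real^'m^'m"
  assumes A: "transpose A = A"
  shows "smallest_eigenvalue A * (norm v)\<^sup>2 \<le> v \<bullet> (A *v v)"
proof -
  have sym: "u \<bullet> (A *v w) = w \<bullet> (A *v u)" for u w
    using A by (metis dot_lmul_matrix transpose_matrix_vector inner_commute)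
  have "compact (sphere (0 :: real^'m) 1)" "sphere (0 :: real^'m) 1 \<noteq> {}"
    by auto
  moreover have "continuous_on (sphere 0 1) (\<lambda>x. x \<bullet> (A *v x))"
    by (intro continuous_intros matrix_vector_mult_linear_continuous_on)
  ultimately obtain x where x: "norm x = 1" "\<And>w. norm w = 1 \<Longrightarrow> x \<bullet> (A *v x) \<le> w \<bullet> (A *v w)"
    using continuous_attains_inf[of "sphere 0 1" "\<lambda>x. x \<bullet> (A *v x)"] by (auto simp: dist_norm)
  define l where "l = x \<bullet> (A *v x)"
  have le: "l * (norm w)\<^sup>2 \<le> w \<bullet> (A *v w)" for w
  proof (cases "w = 0")
    case False
    define u where "u = (1 / norm w) *\<^sub>R w"
    have u: "norm u = 1" "norm w *\<^sub>R u = w"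
      using False by (simp_all add: u_def)
    have "l \<le> u \<bullet> (A *v u)"
      unfolding l_def by (rule x(2)[OF u(1)])
    then have "l * (norm w)\<^sup>2 \<le> (u \<bullet> (A *v u)) * (norm w)\<^sup>2"
      by (rule mult_right_mono) simp
    also have "\<dots> = (norm w *\<^sub>R u) \<bullet> (A *v (norm w *\<^sub>R u))"
      by (simp add: matrix_vector_mult_scaleR power2_eq_square)
    finally show ?thesis
      unfolding u(2) .
  qed simp
  define r where "r = A *v x - l *\<^sub>R x"
  define c where "c = r \<bullet> (A *v r) - l * (norm r)\<^sup>2"
  \<comment> \<open>First variation at the minimiser in the direction \<open>- r\<close>: for small
    positive \<open>t\<close> the linear term dominates and forces \<open>r = 0\<close>.\<close>
  have "0 \<le> t\<^sup>2 * c - 2 * t * (norm r)\<^sup>2" for t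
  proof -
    have "l * (norm (x - t *\<^sub>R r))\<^sup>2 \<le> (x - t *\<^sub>R r) \<bullet> (A *v (x - t *\<^sub>R r))"
      by (rule le)
    moreover have "(norm (x - t *\<^sub>R r))\<^sup>2 = 1 - 2 * t * (r \<bullet> x) + t\<^sup>2 * (norm r)\<^sup>2"
      unfolding power2_norm_eq_inner using x(1)
      by (simp add: inner_diff_left inner_diff_right inner_commute power2_eq_square[of t] norm_eq_1
          algebra_simps)
    moreover have "(x - t *\<^sub>R r) \<bullet> (A *v (x - t *\<^sub>R r)) = l - 2 * t * (r \<bullet> (A *v x)) + t\<^sup>2 * (r \<bullet> (A *v r))"
      using sym[of x r]
      by (simp add: matrix_vector_mult_diff_distrib matrix_vector_mult_scaleR inner_diff_left inner_diff_right
          power2_eq_square[of t] l_def algebra_simps)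
    ultimately have "2 * t * (r \<bullet> (A *v x) - l * (r \<bullet> x)) \<le> t\<^sup>2 * c"
      by (simp add: c_def algebra_simps)
    moreover have "r \<bullet> (A *v x) - l * (r \<bullet> x) = (norm r)\<^sup>2"
      by (simp add: power2_norm_eq_inner) (simp add: r_def inner_diff_right inner_diff_left)
    ultimately show ?thesis
      by simp
  qed
  note nonneg = this
  have "r = 0"
  proof (rule ccontr)
    assume "r \<noteq> 0"
    \<comment> \<open>So small that the quadratic term is at most half of the linear one; adding 1
      avoids division by zero.\<close>
    define t where "t = (norm r)\<^sup>2 / (\<bar>c\<bar> + 1)"
    have t: "t > 0" "t * \<bar>c\<bar> \<le> (norm r)\<^sup>2"
      using \<open>r \<noteq> 0\<close> by (simp_all add: t_def field_simps)
    have "t * (t * c) \<le> t * (norm r)\<^sup>2"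
      using t by (intro mult_left_mono order_trans[OF _ t(2)]) auto
    then have "t * (norm r)\<^sup>2 \<le> 0"
      using nonneg[of t] by (simp add: power2_eq_square)
    moreover have "t * (norm r)\<^sup>2 > 0"
      using t \<open>r \<noteq> 0\<close> by simp
    ultimately show False by simp
  qed
  then have "A *v x = l *\<^sub>R x" "x \<noteq> 0"
    using x(1) by (auto simp: r_def)
  then have "smallest_eigenvalue A \<le> l"
    unfolding smallest_eigenvalue_def by (intro Min_le finite_eigenvalues[OF A]) auto
  then have "smallest_eigenvalue A * (norm v)\<^sup>2 \<le> l * (norm v)\<^sup>2"
    by (intro mult_right_mono) auto
  also have "\<dots> \<le> v \<bullet> (A *v v)"
    by (rule le)
  finally show ?thesis .
qed

subsection \<open>The gradient of the loss\<close>

definition residual ::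
  "('m \<Rightarrow> complex^'n^'n) \<Rightarrow> ('m \<Rightarrow> real) \<Rightarrow> complex^'n^'n \<Rightarrow> real^'m" where
  "residual \<rho> y M = (\<chi> j. Re (trace (\<rho> j ** M)) - y j)"

text \<open>The matrix \<open>X\<close> of the overview; each partial derivative of the loss is its
  inner product with a direction, divided by the number of states.\<close>

definition force ::
  "('m::finite \<Rightarrow> complex^'n^'n) \<Rightarrow> ('m \<Rightarrow> real) \<Rightarrow> complex^'n^'n \<Rightarrow> complex^'n^'n" where
  "force \<rho> y M = (\<Sum>j\<in>UNIV. residual \<rho> y M $ j *\<^sub>R cscale \<i> (commutator M (\<rho> j)))"

lemma loss_eq:
  "loss \<rho> y U H M\<^sub>0 p \<theta> = (norm (residual \<rho> y (observable U H M\<^sub>0 p \<theta>)))\<^sup>2 / (2 * real CARD('m))"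
  for \<rho> :: "'m::finite \<Rightarrow> complex^'n^'n"
  by (simp add: loss_def residual_def norm_vec_def L2_set_def sum_nonneg)

lemma trace_sum: "trace (\<Sum>j\<in>S. A j) = (\<Sum>j\<in>S. trace (A j))"
  for A :: "'a \<Rightarrow> complex^'n^'n"
  unfolding trace_def by (simp add: sum.swap[of _ S])

lemma trace_force: "trace (force \<rho> y M) = 0"
  by (simp add: force_def trace_sum trace_scaleR trace_cscale trace_commutator)

lemma hermitian_force:
  "hermitian M \<Longrightarrow> (\<And>j. hermitian (\<rho> j)) \<Longrightarrow> hermitian (force \<rho> y M)"
  unfolding force_def by (intro hermitian_sum hermitian_scaleR hermitian_i_commutator)

text \<open>\<open>K_asym\<close> is the Gram matrix of the Hermitian matrices
  \<open>cscale \<i> (commutator M (\<rho> j))\<close>.\<close>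

lemma inner_K_asym:
  fixes \<rho> :: "'m::finite \<Rightarrow> complex^'n^'n"
  assumes "hermitian M" "\<And>j. hermitian (\<rho> j)"
  shows "r \<bullet> (K_asym \<rho> M *v r) = (norm (\<Sum>j\<in>UNIV. r $ j *\<^sub>R cscale \<i> (commutator M (\<rho> j))))\<^sup>2"
    and "transpose (K_asym \<rho> M) = K_asym \<rho> M"
proof -
  define B where "B j = cscale \<i> (commutator M (\<rho> j))" for j
  have K: "K_asym \<rho> M $ i $ j = B i \<bullet> B j" for i j
    using assms by (simp add: K_asym_def inner_hermitian hermitian_i_commutator B_def)
  show "r \<bullet> (K_asym \<rho> M *v r) = (norm (\<Sum>j\<in>UNIV. r $ j *\<^sub>R cscale \<i> (commutator M (\<rho> j))))\<^sup>2"
  proof -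
    have "r \<bullet> (K_asym \<rho> M *v r) = (\<Sum>i\<in>UNIV. \<Sum>j\<in>UNIV. r $ i * (r $ j * (B i \<bullet> B j)))"
      by (simp add: inner_vec_def[of r] matrix_vector_mult_def K sum_distrib_left mult_ac)
    also have "\<dots> = (norm (\<Sum>j\<in>UNIV. r $ j *\<^sub>R B j))\<^sup>2"
      by (subst sum.swap)
        (simp add: power2_norm_eq_inner inner_sum_left inner_sum_right sum_distrib_left mult.left_commute)
    finally show ?thesis
      by (simp only: B_def)
  qed
  show "transpose (K_asym \<rho> M) = K_asym \<rho> M"
    by (simp add: transpose_def vec_eq_iff K inner_commute)
qed

text \<open>Product rule, one layer at a time; \<open>H ** V = V ** (dagger V ** H ** V)\<close> for
  unitary \<open>V\<close> moves each generator to the right end. Stated along a curve, it covers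
  both partial derivatives and the flow.\<close>

lemma ansatz_derivative:
  fixes U :: "nat \<Rightarrow> complex^'n^'n" and \<theta> :: "real \<Rightarrow> nat \<Rightarrow> real"
  assumes H: "hermitian H" and U: "\<And>k. k \<le> p \<Longrightarrow> unitary (U k)"
    and \<theta>: "\<And>l. l \<in> {1..p} \<Longrightarrow> ((\<lambda>s. \<theta> s l) has_real_derivative v l) (at t within S)"
  shows "((\<lambda>s. ansatz U H p (\<theta> s)) has_vector_derivative
    ansatz U H p (\<theta> t) ** cscale (- \<i>) (\<Sum>k<p. v (Suc k) *\<^sub>R direction U H k (\<theta> t))) (at t within S)"
  using U \<theta>
proof (induction p)
  case 0
  then show ?case
    by (simp add: cscale_def matrix_mult.zero_right flip: zero_vec_def)
next
  case (Suc p)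
  let ?A = "\<lambda>s. ansatz U H p (\<theta> s)" and ?E = "evolution H (\<theta> t (Suc p))" and ?U = "U (Suc p)"
  let ?Y = "\<Sum>k<p. v (Suc k) *\<^sub>R direction U H k (\<theta> t)"
  have A: "unitary (?A t)"
    using Suc.prems(1) by (intro unitary_ansatz H) auto
  have "((\<lambda>s. evolution H (\<theta> s (Suc p))) has_vector_derivative v (Suc p) *\<^sub>R (cscale (- \<i>) H ** ?E)) (at t within S)"
    using Suc.prems(2)[of "Suc p"]
    by (intro vector_diff_chain_within[unfolded o_def] evolution_derivative)
      (simp add: has_real_derivative_iff_has_vector_derivative)
  then have "((\<lambda>s. ?U ** evolution H (\<theta> s (Suc p)) ** ?A s) has_vector_derivative
      ?U ** ?E ** (?A t ** cscale (- \<i>) ?Y)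
      + (?U ** (v (Suc p) *\<^sub>R (cscale (- \<i>) H ** ?E))) ** ?A t) (at t within S)"
    using Suc.prems
    by (intro matrix_mult.has_vector_derivative Suc.IH
        bounded_linear.has_vector_derivative[OF matrix_mult.bounded_linear_right]) auto
  moreover have "(?U ** (v (Suc p) *\<^sub>R (cscale (- \<i>) H ** ?E))) ** ?A t
      = ?U ** ?E ** ?A t ** cscale (- \<i>) (v (Suc p) *\<^sub>R direction U H p (\<theta> t))"
  proof -
    have "?A t ** direction U H p (\<theta> t) = H ** ?A t"
      unfolding direction_def using A by (simp add: matrix_mul_assoc[symmetric] unitary_cancel)
    then have "?U ** ?E ** ?A t ** direction U H p (\<theta> t) = ?U ** ((?E ** H) ** ?A t)"
      by (simp add: matrix_mul_assoc[symmetric])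
    also have "\<dots> = ?U ** (H ** ?E) ** ?A t"
      by (simp add: evolution_commute matrix_mul_assoc)
    finally show ?thesis
      by (simp add: cscale_mult_left cscale_mult_right cscale_scaleR matrix_mult.scaleR_left matrix_mult.scaleR_right)
  qed
  ultimately show ?case
    unfolding ansatz_Suc sum.lessThan_Suc
    by (simp add: cscale_add matrix_mult.add_right matrix_mul_assoc)
qed

text \<open>The observable evolves by the commutator of \<open>cscale \<i> Y\<close> with
  \<open>M t\<close>; cyclicity of the trace shifts the commutator onto \<rho>, where the residuals
  assemble it into \<open>force\<close>.\<close>

lemma loss_derivative:
  fixes \<rho> :: "'m::finite \<Rightarrow> complex^'n^'n" and \<theta> :: "real \<Rightarrow> nat \<Rightarrow> real"
  assumes \<rho>: "\<And>j. hermitian (\<rho> j)" and M0: "hermitian M\<^sub>0"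
    and H: "hermitian H" and U: "\<And>k. k \<le> p \<Longrightarrow> unitary (U k)"
    and \<theta>: "\<And>l. l \<in> {1..p} \<Longrightarrow> ((\<lambda>s. \<theta> s l) has_real_derivative v l) (at t within S)"
  shows "((\<lambda>s. loss \<rho> y U H M\<^sub>0 p (\<theta> s)) has_real_derivative
    (\<Sum>k<p. v (Suc k) * (direction U H k (\<theta> t) \<bullet> force \<rho> y (observable U H M\<^sub>0 p (\<theta> t)))) / CARD('m)) (at t within S)"
proof -
  define Y where "Y = (\<Sum>k<p. v (Suc k) *\<^sub>R direction U H k (\<theta> t))"
  define M where "M s = observable U H M\<^sub>0 p (\<theta> s)" for s
  have Y: "hermitian Y"
    unfolding Y_def direction_def by (intro hermitian_sum hermitian_scaleR hermitian_conj' H)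
  have M: "hermitian (M s)" for s
    unfolding M_def by (rule hermitian_observable[OF M0])
  have dM: "(M has_vector_derivative M t ** cscale (- \<i>) Y + cscale \<i> Y ** M t) (at t within S)"
  proof -
    let ?A = "\<lambda>s. ansatz U H p (\<theta> s)"
    have "((\<lambda>s. dagger (?A s) ** M\<^sub>0 ** ?A s) has_vector_derivative
        dagger (?A t) ** M\<^sub>0 ** (?A t ** cscale (- \<i>) Y)
        + (dagger (?A t ** cscale (- \<i>) Y) ** M\<^sub>0) ** ?A t) (at t within S)"
      unfolding Y_def
      by (intro matrix_mult.has_vector_derivative ansatz_derivative H U \<theta>
          bounded_linear.has_vector_derivative[OF matrix_mult.bounded_linear_left]
          bounded_linear.has_vector_derivative[OF bounded_linear_dagger])
    moreover have "dagger (?A t ** cscale (- \<i>) Y) = cscale \<i> Y ** dagger (?A t)"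
      using Y by (simp add: dagger_mult dagger_cscale hermitian_def)
    ultimately show ?thesis
      by (simp add: M_def[abs_def] observable_def matrix_mul_assoc)
  qed
  have inner: "\<rho> j \<bullet> (M t ** cscale (- \<i>) Y + cscale \<i> Y ** M t) = Y \<bullet> cscale \<i> (commutator (M t) (\<rho> j))" for j
  proof -
    have "trace (\<rho> j ** (Y ** M t)) = trace (Y ** (M t ** \<rho> j))"
      using trace_mul_sym[of "\<rho> j" "Y ** M t"] by (simp add: matrix_mul_assoc)
    moreover have "trace (\<rho> j ** (M t ** Y)) = trace (Y ** (\<rho> j ** M t))"
      using trace_mul_sym[of "\<rho> j ** M t" Y] by (simp add: matrix_mul_assoc)
    ultimately show ?thesis
      unfolding inner_hermitian[OF \<rho>] inner_hermitian[OF Y] commutator_def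
      by (simp add: matrix_mult.add_right matrix_mult.diff_right cscale_mult_left cscale_mult_right
          trace_add trace_sub trace_cscale)
  qed
  have r: "((\<lambda>s. residual \<rho> y (M s) $ j) has_real_derivative Y \<bullet> cscale \<i> (commutator (M t) (\<rho> j))) (at t within S)" for j
  proof -
    have "((\<lambda>s. \<rho> j \<bullet> M s) has_vector_derivative \<rho> j \<bullet> (M t ** cscale (- \<i>) Y + cscale \<i> Y ** M t)) (at t within S)"
      by (rule bounded_linear.has_vector_derivative[OF bounded_linear_inner_right dM])
    then have "((\<lambda>s. \<rho> j \<bullet> M s - y j) has_real_derivative Y \<bullet> cscale \<i> (commutator (M t) (\<rho> j))) (at t within S)"
      unfolding inner has_real_derivative_iff_has_vector_derivative[symmetric]
      by (auto intro!: derivative_eq_intros)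
    then show ?thesis
      by (simp add: residual_def inner_hermitian[OF \<rho>])
  qed
  have "((\<lambda>s. (\<Sum>j\<in>UNIV. (residual \<rho> y (M s) $ j)\<^sup>2) / (2 * real CARD('m))) has_real_derivative
      (\<Sum>j\<in>UNIV. 2 * residual \<rho> y (M t) $ j * (Y \<bullet> cscale \<i> (commutator (M t) (\<rho> j)))) / (2 * real CARD('m)))
      (at t within S)"
    by (auto intro!: derivative_eq_intros r sum.cong)
  moreover have "(\<Sum>j\<in>UNIV. 2 * residual \<rho> y (M t) $ j * (Y \<bullet> cscale \<i> (commutator (M t) (\<rho> j)))) / (2 * real CARD('m))
      = (Y \<bullet> force \<rho> y (M t)) / CARD('m)"
    by (simp add: force_def inner_sum_right sum_distrib_left mult.assoc flip: sum_distrib_left)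
  moreover have "Y \<bullet> force \<rho> y (M t) = (\<Sum>k<p. v (Suc k) * (direction U H k (\<theta> t) \<bullet> force \<rho> y (M t)))"
    by (simp add: Y_def inner_sum_left)
  moreover have "loss \<rho> y U H M\<^sub>0 p (\<theta> s) = (\<Sum>j\<in>UNIV. (residual \<rho> y (M s) $ j)\<^sup>2) / (2 * real CARD('m))" for s
    by (simp add: loss_def residual_def M_def)
  ultimately show ?thesis
    by (simp add: M_def)
qed

lemma partial_deriv_loss:
  fixes \<rho> :: "'m::finite \<Rightarrow> complex^'n^'n"
  assumes "\<And>j. hermitian (\<rho> j)" "hermitian M\<^sub>0" "hermitian H" "\<And>k. k \<le> p \<Longrightarrow> unitary (U k)"
    and k: "k < p"
  shows "partial_deriv (Suc k) (loss \<rho> y U H M\<^sub>0 p) \<theta>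
    = (direction U H k \<theta> \<bullet> force \<rho> y (observable U H M\<^sub>0 p \<theta>)) / CARD('m)"
proof -
  \<comment> \<open>Velocity of the coordinate line on which only the parameter \<open>Suc k\<close>
    moves.\<close>
  define v :: "nat \<Rightarrow> real" where "v l = (if l = Suc k then 1 else 0)" for l
  have "((\<lambda>x. (\<theta>(Suc k := x)) l) has_real_derivative v l) (at (\<theta> (Suc k)) within UNIV)" for l
    by (cases "l = Suc k") (simp_all add: v_def)
  then have "((\<lambda>x. loss \<rho> y U H M\<^sub>0 p (\<theta>(Suc k := x))) has_real_derivative
    (\<Sum>j<p. v (Suc j) * (direction U H j (\<theta>(Suc k := \<theta> (Suc k)))
      \<bullet> force \<rho> y (observable U H M\<^sub>0 p (\<theta>(Suc k := \<theta> (Suc k)))))) / CARD('m)) (at (\<theta> (Suc k)) within UNIV)"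
    by (intro loss_derivative assms)
  then have "((\<lambda>x. loss \<rho> y U H M\<^sub>0 p (\<theta>(Suc k := x))) has_real_derivative
    (\<Sum>j<p. v (Suc j) * (direction U H j \<theta> \<bullet> force \<rho> y (observable U H M\<^sub>0 p \<theta>))) / CARD('m)) (at (\<theta> (Suc k)))"
    by simp
  then show ?thesis
    unfolding partial_deriv_def using k
    by (simp add: DERIV_imp_deriv v_def if_distrib[of "\<lambda>x. x * _"] sum.delta cong: if_cong)
qed

section \<open>Size of the gradient and of the residuals\<close>

lemma norm_force_le:
  fixes \<rho> :: "'m::finite \<Rightarrow> complex^'n^'n"
  assumes K: "\<And>(A :: complex^'n^'n) (B :: complex^'n^'n). norm (A ** B) \<le> norm A * norm B * K"
  shows "norm (force \<rho> y M) \<le> norm (residual \<rho> y M) * (2 * K * norm M * (\<Sum>j\<in>UNIV. norm (\<rho> j)))"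
proof -
  have comm: "norm (cscale \<i> (commutator M A)) \<le> 2 * K * norm M * norm A" for A
  proof -
    have "norm (cscale \<i> (commutator M A)) = norm (M ** A - A ** M)"
      by (simp add: cscale_def norm_vec_def norm_mult commutator_def)
    also have "\<dots> \<le> norm (M ** A) + norm (A ** M)"
      by (rule norm_triangle_ineq4)
    also have "\<dots> \<le> 2 * K * norm M * norm A"
      using K[of M A] K[of A M] by (simp add: mult_ac)
    finally show ?thesis .
  qed
  have "norm (force \<rho> y M) \<le> (\<Sum>j\<in>UNIV. norm (residual \<rho> y M $ j *\<^sub>R cscale \<i> (commutator M (\<rho> j))))"
    unfolding force_def by (rule norm_sum)
  also have "\<dots> \<le> (\<Sum>j\<in>UNIV. norm (residual \<rho> y M) * (2 * K * norm M * norm (\<rho> j)))"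
    unfolding norm_scaleR real_norm_def
    by (intro sum_mono mult_mono component_le_norm_cart comm) auto
  finally show ?thesis
    by (simp add: sum_distrib_left)
qed

text \<open>Depends on \<open>M\<close> only through its norm, which conjugation preserves; the
  initial loss is thereby bounded uniformly in the gates.\<close>

lemma norm_residual_le:
  fixes \<rho> :: "'m::finite \<Rightarrow> complex^'n^'n"
  assumes "\<And>j. hermitian (\<rho> j)"
  shows "norm (residual \<rho> y M) \<le> (\<Sum>j\<in>UNIV. norm (\<rho> j) * norm M + \<bar>y j\<bar>)"
proof -
  have "norm (residual \<rho> y M) \<le> (\<Sum>j\<in>UNIV. \<bar>residual \<rho> y M $ j\<bar>)"
    by (rule norm_le_l1_cart)
  also have "\<dots> \<le> (\<Sum>j\<in>UNIV. norm (\<rho> j) * norm M + \<bar>y j\<bar>)"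
  proof (rule sum_mono)
    fix j
    have "\<bar>\<rho> j \<bullet> M\<bar> \<le> norm (\<rho> j) * norm M"
      by (rule Cauchy_Schwarz_ineq2)
    then show "\<bar>residual \<rho> y M $ j\<bar> \<le> norm (\<rho> j) * norm M + \<bar>y j\<bar>"
      by (simp add: residual_def inner_hermitian[OF assms])
  qed
  finally show ?thesis .
qed

subsection \<open>Exponential decay along the flow\<close>

lemma nonincreasing_Ici:
  fixes f :: "real \<Rightarrow> real"
  assumes "0 \<le> T" "\<And>t. 0 \<le> t \<Longrightarrow> (f has_real_derivative f' t) (at t within {0..})"
    and "\<And>t. 0 < t \<Longrightarrow> t < T \<Longrightarrow> f' t \<le> 0"
  shows "f T \<le> f 0"
proof (cases "T = 0")
  case False
  show ?thesis
  proof (rule DERIV_nonpos_imp_decreasing_open[where a = 0 and b = T and f = f])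
    show "0 \<le> T" by (rule assms(1))
    show "continuous_on {0..T} f"
      by (rule continuous_on_subset[of "{0..}"])
        (auto intro!: DERIV_continuous_on assms)
    fix t assume t: "0 < t" "t < T"
    then have "at t within {0..} = at t"
      by (intro at_within_interior) simp
    then show "\<exists>y. (f has_real_derivative y) (at t) \<and> y \<le> 0"
      using assms(2)[of t] assms(3)[OF t] t by auto
  qed
qed simp

text \<open>A bootstrap: decay of the loss is only known while \<open>\<theta>\<close> stays within distance
  \<open>r\<close> of its starting point, but under this decay the path is too short to get that far.\<close>

lemma exponential_decay_bootstrap:
  fixes \<theta> v :: "real \<Rightarrow> nat \<Rightarrow> real" and L L' :: "real \<Rightarrow> real" and a c r :: real
  assumes I: "finite I" and c: "c > 0" and a: "a \<ge> 0"
    and \<theta>: "\<And>l t. l \<in> I \<Longrightarrow> 0 \<le> t \<Longrightarrow> ((\<lambda>s. \<theta> s l) has_real_derivative v t l) (at t within {0..})"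
    and L: "\<And>t. 0 \<le> t \<Longrightarrow> (L has_real_derivative L' t) (at t within {0..})"
    and L_nonneg: "\<And>t. 0 \<le> L t"
    and decay: "\<And>t. 0 \<le> t \<Longrightarrow> (\<forall>l\<in>I. \<bar>\<theta> t l - \<theta> 0 l\<bar> \<le> r) \<Longrightarrow> L' t \<le> - c * L t"
    and speed: "\<And>l t. l \<in> I \<Longrightarrow> 0 \<le> t \<Longrightarrow> \<bar>v t l\<bar> \<le> a * sqrt (L t)"
    and r: "2 * a / c * sqrt (L 0) < r"
    and t: "0 \<le> t"
  shows "L t \<le> L 0 * exp (- (c * t))"
proof -
  \<comment> \<open>Gronwall's argument with the integrating factor
    \<open>exp (c * t)\<close>.\<close>
  have L_le: "L t \<le> L 0 * exp (- (c * t))"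
    if "0 \<le> t" and close: "\<And>s. 0 \<le> s \<Longrightarrow> s < t \<Longrightarrow> \<forall>l\<in>I. \<bar>\<theta> s l - \<theta> 0 l\<bar> \<le> r" for t
  proof -
    have "L t * exp (c * t) \<le> L 0 * exp (c * 0)"
    proof (rule nonincreasing_Ici[OF that(1), of "\<lambda>t. L t * exp (c * t)"])
      show "((\<lambda>t. L t * exp (c * t)) has_real_derivative (L' s + c * L s) * exp (c * s)) (at s within {0..})"
        if "0 \<le> s" for s
        by (auto intro!: derivative_eq_intros L that simp: algebra_simps)
      show "(L' s + c * L s) * exp (c * s) \<le> 0" if "0 < s" "s < t" for s
        using decay[OF _ close, of s] that by (intro mult_nonpos_nonneg) auto
    qed
    then show ?thesis
      by (simp add: exp_minus field_simps)
  qed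
  have r_pos: "r > 0"
  proof -
    have "0 \<le> 2 * a / c * sqrt (L 0)" using a c L_nonneg by simp
    with r show ?thesis by linarith
  qed
  have "\<forall>l\<in>I. \<bar>\<theta> s l - \<theta> 0 l\<bar> \<le> r" if "0 \<le> s" for s
  proof (rule ccontr)
    assume "\<not> (\<forall>l\<in>I. \<bar>\<theta> s l - \<theta> 0 l\<bar> \<le> r)"
    then obtain l1 where l1: "l1 \<in> I" "r \<le> \<bar>\<theta> s l1 - \<theta> 0 l1\<bar>" by force
    \<comment> \<open>Times at which some coordinate has reached distance \<open>r\<close>. The weak
      inequality makes the set compact, so there is a first such time \<open>T\<close>.\<close>
    define X where "X = (\<Union>l\<in>I. {u \<in> {0..s}. r \<le> \<bar>\<theta> u l - \<theta> 0 l\<bar>})"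
    have "compact X"
      unfolding X_def
    proof (intro compact_UN I)
      fix l assume l: "l \<in> I"
      have "continuous_on {0..s} (\<lambda>u. \<theta> u l)"
        by (rule continuous_on_subset[of "{0..}"]) (auto intro!: DERIV_continuous_on \<theta> l)
      then have "closed {u \<in> {0..s}. r \<le> \<bar>\<theta> u l - \<theta> 0 l\<bar>}"
        by (intro continuous_on_closed_Collect_le) (auto intro!: continuous_intros)
      then show "compact {u \<in> {0..s}. r \<le> \<bar>\<theta> u l - \<theta> 0 l\<bar>}"
        by (rule compact_eq_bounded_closed[THEN iffD2, OF conjI, rotated])
          (rule bounded_subset[of "{0..s}"], auto)
    qed
    moreover have "X \<noteq> {}"
      using l1 that by (auto simp: X_def)
    ultimately obtain T where T: "T \<in> X" "\<And>u. u \<in> X \<Longrightarrow> T \<le> u"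
      using compact_attains_inf by metis
    then obtain l where l: "l \<in> I" "r \<le> \<bar>\<theta> T l - \<theta> 0 l\<bar>" "0 \<le> T" "T \<le> s"
      by (auto simp: X_def)
    have close: "\<forall>l\<in>I. \<bar>\<theta> u l - \<theta> 0 l\<bar> \<le> r" if "0 \<le> u" "u < T" for u
    proof
      fix l' assume "l' \<in> I"
      show "\<bar>\<theta> u l' - \<theta> 0 l'\<bar> \<le> r"
      proof (rule ccontr)
        assume "\<not> \<bar>\<theta> u l' - \<theta> 0 l'\<bar> \<le> r"
        then have "u \<in> X"
          unfolding X_def using that l by (intro UN_I[OF \<open>l' \<in> I\<close>]) auto
        with T(2)[of u] that show False by simp
      qed
    qed
    define b where "b = a * sqrt (L 0)"
    have v: "\<bar>v u l\<bar> \<le> b * exp (- (c / 2 * u))" if "0 \<le> u" "u < T" for u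
    proof -
      have "L u \<le> L 0 * exp (- (c * u))"
        using that by (intro L_le close) auto
      then have "sqrt (L u) \<le> sqrt (L 0 * exp (- (c * u)))"
        by simp
      also have "exp (- (c * u)) = (exp (- (c / 2 * u)))\<^sup>2"
        by (simp add: exp_double[symmetric])
      also have "sqrt (L 0 * (exp (- (c / 2 * u)))\<^sup>2) = sqrt (L 0) * exp (- (c / 2 * u))"
        by (simp add: real_sqrt_mult)
      finally have "a * sqrt (L u) \<le> a * (sqrt (L 0) * exp (- (c / 2 * u)))"
        using a by (rule mult_left_mono)
      with speed[OF l(1) that(1)] show ?thesis
        by (simp add: b_def)
    qed
    \<comment> \<open>The added exponential is the integral of the speed bound from \<open>u\<close>
      to infinity; its rate is \<open>c / 2\<close> because the speed is controlled by
      \<open>sqrt (L u)\<close>. The signs \<sigma> = 1 and -1 together bound the absolute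
      displacement by \<open>2 * b / c\<close>, which is below \<open>r\<close>.\<close>
    have bound: "\<sigma> * \<theta> T l + 2 * b / c * exp (- (c / 2 * T)) \<le> \<sigma> * \<theta> 0 l + 2 * b / c * exp (- (c / 2 * 0))"
      if \<sigma>: "\<bar>\<sigma>\<bar> = 1" for \<sigma> :: real
    proof (rule nonincreasing_Ici[OF l(3), of "\<lambda>u. \<sigma> * \<theta> u l + 2 * b / c * exp (- (c / 2 * u))"])
      show "((\<lambda>u. \<sigma> * \<theta> u l + 2 * b / c * exp (- (c / 2 * u))) has_real_derivative
          \<sigma> * v u l - b * exp (- (c / 2 * u))) (at u within {0..})" if "0 \<le> u" for u
        using c by (auto intro!: derivative_eq_intros \<theta> l that)
      show "\<sigma> * v u l - b * exp (- (c / 2 * u)) \<le> 0" if "0 < u" "u < T" for u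
      proof -
        have "\<sigma> * v u l \<le> \<bar>v u l\<bar>"
          using \<sigma> abs_ge_self[of "\<sigma> * v u l"] by (simp add: abs_mult)
        with v[of u] that show ?thesis by simp
      qed
    qed
    have "2 * b / c * exp (- (c / 2 * T)) \<ge> 0"
      using a c L_nonneg by (simp add: b_def)
    then have "\<bar>\<theta> T l - \<theta> 0 l\<bar> \<le> 2 * b / c"
      using bound[of 1] bound[of "-1"] by simp
    with l(2) r show False
      by (simp add: b_def)
  qed
  then show ?thesis
    using t by (intro L_le) auto
qed

text \<open>A traceless matrix of size one vanishes. This ensures that \<open>d\<^sup>2 - 1\<close>
  is positive.\<close>

lemma card_ge_2_of_traceless:
  fixes H :: "complex^'n^'n"
  assumes "H \<noteq> 0" "trace H = 0"
  shows "CARD('n) \<ge> 2"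
proof (rule ccontr)
  assume "\<not> CARD('n) \<ge> 2"
  then have "CARD('n) = 1"
    using zero_less_card_finite[where 'a = 'n] by linarith
  then obtain i :: 'n where "UNIV = {i}"
    by (auto simp: card_1_singleton_iff)
  then have "j = i" for j :: 'n
    by auto
  moreover have "H $ i $ i = 0"
    using assms(2) unfolding trace_def \<open>UNIV = {i}\<close> by simp
  ultimately have "H $ a $ b = 0" for a b
    by metis
  then have "H = 0"
    by (simp add: vec_eq_iff)
  with assms(1) show False by simp
qed

theorem theorem4p2:
  fixes \<rho> :: "'m::finite \<Rightarrow> complex^'n^'n"
    and y :: "'m \<Rightarrow> real"
    and M\<^sub>0 H :: "complex^'n^'n"
    and \<mu> :: "(complex^'n^'n) measure"
    and C\<^sub>0 \<delta> :: real
  assumes "\<And>j. quantum_state (\<rho> j)"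
    and "hermitian M\<^sub>0"
    and "hermitian H" and "H \<noteq> 0" and "trace H = 0"
    and "haar_SU \<mu>"
    and "C\<^sub>0 > 0"
    and "0 < \<delta>" and "\<delta> < 1"
  shows "\<exists>p\<^sub>0\<ge>1. \<forall>p\<ge>p\<^sub>0. \<forall>\<theta>\<^sub>0 :: nat \<Rightarrow> real.
    with_prob_ge (iid_law \<mu> p) (1 - \<delta>) (\<lambda>U.
      \<forall>\<theta>. gradient_flow p (learning_rate CARD('m) H p) (loss \<rho> y U H M\<^sub>0 p) \<theta>\<^sub>0 \<theta> \<longrightarrow>
        (\<forall>t\<ge>0. smallest_eigenvalue (K_asym \<rho> (observable U H M\<^sub>0 p (\<theta> t))) > C\<^sub>0) \<longrightarrow>
        (\<forall>t\<ge>0. loss \<rho> y U H M\<^sub>0 p (\<theta> t)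
                 \<le> loss \<rho> y U H M\<^sub>0 p (\<theta> 0) * exp (- (C\<^sub>0 * t / 2))))"
proof -
  interpret haar_measure \<mu>
    by standard (rule assms(6))
  have \<rho>: "hermitian (\<rho> j)" for j
    using assms(1)[of j] by (simp add: quantum_state_def)
  note M0 = assms(2) and H = assms(3,5,4)
  have card: "CARD('n) \<ge> 2"
    using assms(4,5) by (rule card_ge_2_of_traceless)
  obtain K where K: "K > 0" "\<And>(A :: complex^'n^'n) (B :: complex^'n^'n). norm (A ** B) \<le> norm A * norm B * K"
    using norm_matrix_mult_le by blast
  define m where "m = real CARD('m)"
  define \<kappa> where "\<kappa> = (norm H)\<^sup>2 / ((real CARD('n))\<^sup>2 - 1)"
  define \<beta> where "\<beta> = 2 * K * norm M\<^sub>0 * (\<Sum>j\<in>UNIV. norm (\<rho> j))"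
  define \<Lambda> where "\<Lambda> = (\<Sum>j\<in>UNIV. norm (\<rho> j) * norm M\<^sub>0 + \<bar>y j\<bar>)"
  \<comment> \<open>\<open>p\<close> times the path length allowed by the bootstrap, with \<beta>
    bounding the force per unit of residual and \<Lambda> the initial residual; the added 1 makes
    the inequality strict.\<close>
  define R where "R = 4 * norm H * \<beta> * \<Lambda> / (C\<^sub>0 * \<kappa>) + 1"
  have m: "m > 0"
    by (simp add: m_def)
  have "(real CARD('n))\<^sup>2 - 1 > 0"
    using card by (simp add: one_less_power)
  then have \<kappa>: "\<kappa> > 0"
    using assms(4) by (simp add: \<kappa>_def)
  have nonneg: "\<beta> \<ge> 0" "\<Lambda> \<ge> 0"
    using K by (auto simp: \<beta>_def \<Lambda>_def intro!: mult_nonneg_nonneg sum_nonneg)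
  then have R: "R > 0"
    using assms(7) \<kappa> unfolding R_def by (intro add_nonneg_pos divide_nonneg_pos) auto
  obtain p\<^sub>0 where p0: "p\<^sub>0 \<ge> 1" "\<And>p \<theta>\<^sub>0. p \<ge> p\<^sub>0 \<Longrightarrow>
    \<exists>A\<in>sets (iid_law \<mu> p). 1 - \<delta> \<le> measure (iid_law \<mu> p) A \<and>
    (\<forall>U\<in>A. (\<forall>k\<le>p. U k \<in> SU) \<and>
      (\<forall>\<theta> X. (\<forall>l\<in>{1..p}. \<bar>\<theta> l - \<theta>\<^sub>0 l\<bar> \<le> R / p) \<longrightarrow> hermitian X \<longrightarrow> trace X = 0 \<longrightarrow>
        p * \<kappa> * (norm X)\<^sup>2 / 4 \<le> (\<Sum>k<p. (direction U H k \<theta> \<bullet> X)\<^sup>2)))"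
    using uniform_lower_bound[OF H card R assms(8)] unfolding \<kappa>_def by blast
  show ?thesis
  proof (intro exI[of _ p\<^sub>0] conjI p0(1) allI impI)
    fix p and \<theta>\<^sub>0 :: "nat \<Rightarrow> real" assume "p\<^sub>0 \<le> p"
    with p0(1) have p: "real p > 0" by simp
    obtain A where A: "A \<in> sets (iid_law \<mu> p)" "1 - \<delta> \<le> measure (iid_law \<mu> p) A"
      and SU: "\<And>U k. U \<in> A \<Longrightarrow> k \<le> p \<Longrightarrow> U k \<in> SU"
      and lower: "\<And>U \<theta> X. U \<in> A \<Longrightarrow> \<forall>l\<in>{1..p}. \<bar>\<theta> l - \<theta>\<^sub>0 l\<bar> \<le> R / p \<Longrightarrow> hermitian X \<Longrightarrow> trace X = 0 \<Longrightarrow>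
        p * \<kappa> * (norm X)\<^sup>2 / 4 \<le> (\<Sum>k<p. (direction U H k \<theta> \<bullet> X)\<^sup>2)"
      using p0(2)[OF \<open>p\<^sub>0 \<le> p\<close>, of \<theta>\<^sub>0] by blast
    show "with_prob_ge (iid_law \<mu> p) (1 - \<delta>) (\<lambda>U.
      \<forall>\<theta>. gradient_flow p (learning_rate CARD('m) H p) (loss \<rho> y U H M\<^sub>0 p) \<theta>\<^sub>0 \<theta> \<longrightarrow>
        (\<forall>t\<ge>0. smallest_eigenvalue (K_asym \<rho> (observable U H M\<^sub>0 p (\<theta> t))) > C\<^sub>0) \<longrightarrow>
        (\<forall>t\<ge>0. loss \<rho> y U H M\<^sub>0 p (\<theta> t)
                 \<le> loss \<rho> y U H M\<^sub>0 p (\<theta> 0) * exp (- (C\<^sub>0 * t / 2))))"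
      unfolding with_prob_ge_def
    proof (intro bexI[OF _ A(1)] conjI A(2) ballI allI impI)
      \<comment> \<open>The path depends on \<open>U\<close>, but the event does not depend on the
        path: \<open>lower\<close> holds for all nearby parameters at once.\<close>
      fix U \<theta> and t :: real
      assume U: "U \<in> A"
        and flow: "gradient_flow p (learning_rate CARD('m) H p) (loss \<rho> y U H M\<^sub>0 p) \<theta>\<^sub>0 \<theta>"
        and eig: "\<forall>t\<ge>0. smallest_eigenvalue (K_asym \<rho> (observable U H M\<^sub>0 p (\<theta> t))) > C\<^sub>0"
        and t: "0 \<le> t"
      have unitary_U: "unitary (U k)" if "k \<le> p" for k
        using SU[OF U that] by (rule unitary_SU)
      define L where "L t = loss \<rho> y U H M\<^sub>0 p (\<theta> t)" for t
      define M where "M t = observable U H M\<^sub>0 p (\<theta> t)" for t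
      define X where "X t = force \<rho> y (M t)" for t
      define v where "v t l = - learning_rate CARD('m) H p * partial_deriv l (loss \<rho> y U H M\<^sub>0 p) (\<theta> t)" for t l
      have M: "hermitian (M t)" "norm (M t) = norm M\<^sub>0" for t
        unfolding M_def observable_def
        using hermitian_conj'[OF M0] norm_conj(2)[OF unitary_ansatz[OF H(1) unitary_U, of p]] by auto
      have X: "hermitian (X t)" "trace (X t) = 0" for t
        unfolding X_def using M \<rho> by (auto intro: hermitian_force trace_force)
      have L: "(norm (residual \<rho> y (M t)))\<^sup>2 = 2 * m * L t" for t
        using m by (simp add: L_def loss_eq M_def m_def)
      \<comment> \<open>The factor \<open>m\<close> of the learning rate cancels the one in the
        gradient, and \<open>(norm H)\<^sup>2\<close> is the trace of \<open>H ** H\<close>.\<close>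
      have v: "v t (Suc k) = - (direction U H k (\<theta> t) \<bullet> X t) / (p * \<kappa>)" if "k < p" for k t
      proof -
        have "learning_rate CARD('m) H p = m / (p * \<kappa>)"
          by (simp add: learning_rate_def \<kappa>_def m_def power2_norm_eq_inner inner_hermitian[OF H(1)])
        moreover have "partial_deriv (Suc k) (loss \<rho> y U H M\<^sub>0 p) (\<theta> t) = (direction U H k (\<theta> t) \<bullet> X t) / m"
          unfolding X_def M_def m_def by (intro partial_deriv_loss \<rho> M0 H unitary_U that)
        ultimately show ?thesis
          using m by (simp add: v_def)
      qed
      have \<theta>: "((\<lambda>s. \<theta> s l) has_real_derivative v t l) (at t within {0..})" if "l \<in> {1..p}" "0 \<le> t" for l t
        using flow that unfolding gradient_flow_def v_def by blast
      have start: "\<theta> 0 l = \<theta>\<^sub>0 l" if "l \<in> {1..p}" for l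
        using flow that unfolding gradient_flow_def by blast
      have dL: "(L has_real_derivative - (\<Sum>k<p. (direction U H k (\<theta> t) \<bullet> X t)\<^sup>2) / (m * p * \<kappa>)) (at t within {0..})"
        if "0 \<le> t" for t
      proof -
        have "(L has_real_derivative (\<Sum>k<p. v t (Suc k) * (direction U H k (\<theta> t) \<bullet> X t)) / m) (at t within {0..})"
          unfolding L_def[abs_def] X_def M_def m_def
          by (rule loss_derivative[OF \<rho> M0 H(1) unitary_U \<theta>[OF _ that]])
        also have "(\<Sum>k<p. v t (Suc k) * (direction U H k (\<theta> t) \<bullet> X t)) / m
            = - (\<Sum>k<p. (direction U H k (\<theta> t) \<bullet> X t)\<^sup>2) / (m * p * \<kappa>)"
          by (simp add: v power2_eq_square sum_negf mult_ac flip: sum_divide_distrib)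
        finally show ?thesis .
      qed
      have "L t \<le> L 0 * exp (- (C\<^sub>0 / 2 * t))"
      proof (rule exponential_decay_bootstrap[where I = "{1..p}" and r = "R / p" and c = "C\<^sub>0 / 2"
            and a = "norm H * \<beta> * sqrt (2 * m) / (p * \<kappa>)", OF _ _ _ \<theta> dL _ _ _ _ t])
        show "finite {1..p}" "0 < C\<^sub>0 / 2"
          using assms(7) by simp_all
        show "0 \<le> norm H * \<beta> * sqrt (2 * m) / (p * \<kappa>)"
          using nonneg p \<kappa> m by simp
        show "0 \<le> L t" for t
          by (simp add: L_def loss_eq)
        \<comment> \<open>The rate \<open>C\<^sub>0 / 2\<close> arises from the factor 1/4 in
          \<open>lower\<close> and the factor 2 in the squared residual norm
          \<open>2 * m * L t\<close>.\<close>
        show "- (\<Sum>k<p. (direction U H k (\<theta> t) \<bullet> X t)\<^sup>2) / (m * p * \<kappa>) \<le> - (C\<^sub>0 / 2) * L t"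
          if "0 \<le> t" and close: "\<forall>l\<in>{1..p}. \<bar>\<theta> t l - \<theta> 0 l\<bar> \<le> R / p" for t
        proof -
          define r where "r = residual \<rho> y (M t)"
          have "C\<^sub>0 \<le> smallest_eigenvalue (K_asym \<rho> (M t))"
            using eig that(1) by (simp add: M_def less_imp_le)
          then have "C\<^sub>0 * (norm r)\<^sup>2 \<le> smallest_eigenvalue (K_asym \<rho> (M t)) * (norm r)\<^sup>2"
            by (rule mult_right_mono) simp
          also have "\<dots> \<le> r \<bullet> (K_asym \<rho> (M t) *v r)"
            by (rule smallest_eigenvalue_le[OF inner_K_asym(2)[OF M(1) \<rho>]])
          also have "\<dots> = (norm (X t))\<^sup>2"
            unfolding inner_K_asym(1)[OF M(1) \<rho>] X_def force_def r_def ..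
          finally have "C\<^sub>0 * (2 * m * L t) \<le> (norm (X t))\<^sup>2"
            unfolding r_def L .
          then have "p * \<kappa> * (C\<^sub>0 * (2 * m * L t)) / 4 \<le> p * \<kappa> * (norm (X t))\<^sup>2 / 4"
            using p \<kappa> by (intro divide_right_mono mult_left_mono) auto
          also have "\<dots> \<le> (\<Sum>k<p. (direction U H k (\<theta> t) \<bullet> X t)\<^sup>2)"
            using close by (intro lower U X) (simp add: start)
          finally show ?thesis
            using p \<kappa> m by (simp add: field_simps)
        qed
        show "\<bar>v t l\<bar> \<le> norm H * \<beta> * sqrt (2 * m) / (p * \<kappa>) * sqrt (L t)"
          if l: "l \<in> {1..p}" and "0 \<le> t" for l t
        proof -
          obtain k where k: "l = Suc k" "k < p"
            using l that by (cases l) auto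
          have "norm (X t) \<le> norm (residual \<rho> y (M t)) * \<beta>"
            unfolding X_def \<beta>_def M(2)[of t, symmetric] by (rule norm_force_le[OF K(2)])
          also have "norm (residual \<rho> y (M t)) = sqrt (2 * m * L t)"
            unfolding L[symmetric] by simp
          finally have "norm (X t) \<le> sqrt (2 * m) * sqrt (L t) * \<beta>"
            by (simp only: real_sqrt_mult)
          then have "norm H * norm (X t) \<le> norm H * (sqrt (2 * m) * sqrt (L t) * \<beta>)"
            by (rule mult_left_mono) simp
          moreover have "norm (direction U H k (\<theta> t)) = norm H"
            using k by (intro norm_direction H unitary_U) auto
          ultimately have "\<bar>direction U H k (\<theta> t) \<bullet> X t\<bar> \<le> norm H * (sqrt (2 * m) * sqrt (L t) * \<beta>)"
            using Cauchy_Schwarz_ineq2[of "direction U H k (\<theta> t)" "X t"] by simp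
          then have "\<bar>direction U H k (\<theta> t) \<bullet> X t\<bar> / (p * \<kappa>) \<le> norm H * (sqrt (2 * m) * sqrt (L t) * \<beta>) / (p * \<kappa>)"
            using p \<kappa> by (intro divide_right_mono) auto
          then show ?thesis
            using p \<kappa> unfolding k(1) v[OF k(2)] by (simp add: abs_mult mult_ac)
        qed
        show "2 * (norm H * \<beta> * sqrt (2 * m) / (p * \<kappa>)) / (C\<^sub>0 / 2) * sqrt (L 0) < R / p"
        proof -
          have "sqrt (2 * m) * sqrt (L 0) = norm (residual \<rho> y (M 0))"
            unfolding real_sqrt_mult[symmetric] L[symmetric] by simp
          also have "\<dots> \<le> \<Lambda>"
            using norm_residual_le[where \<rho> = \<rho> and y = y and M = "M 0", OF \<rho>] by (simp add: M(2) \<Lambda>_def)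
          finally have "4 * norm H * \<beta> / (C\<^sub>0 * \<kappa>) * (sqrt (2 * m) * sqrt (L 0)) \<le> 4 * norm H * \<beta> / (C\<^sub>0 * \<kappa>) * \<Lambda>"
            using nonneg assms(7) \<kappa> by (intro mult_left_mono) auto
          then have "4 * norm H * \<beta> / (C\<^sub>0 * \<kappa>) * (sqrt (2 * m) * sqrt (L 0)) < R"
            by (simp add: R_def)
          then have "4 * norm H * \<beta> / (C\<^sub>0 * \<kappa>) * (sqrt (2 * m) * sqrt (L 0)) / p < R / p"
            using p by (rule divide_strict_right_mono)
          moreover have "2 * (norm H * \<beta> * sqrt (2 * m) / (p * \<kappa>)) / (C\<^sub>0 / 2) * sqrt (L 0)
              = 4 * norm H * \<beta> / (C\<^sub>0 * \<kappa>) * (sqrt (2 * m) * sqrt (L 0)) / p"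
            using p \<kappa> assms(7) by (simp add: field_simps)
          ultimately show ?thesis by simp
        qed
      qed
      then show "loss \<rho> y U H M\<^sub>0 p (\<theta> t) \<le> loss \<rho> y U H M\<^sub>0 p (\<theta> 0) * exp (- (C\<^sub>0 * t / 2))"
        by (simp add: L_def)
    qed
  qed
qed

end
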